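(* Let $n,t$ be positive integers with $n\geq \frac{10t}{3}+10$. Then the minimum number of edges of a $(P_6+tP_2)$-saturated graph on $n$ vertices having no isolated vertices equals $n-\lfloor \frac{n}{10}\rfloor$.
   Context: All graphs are finite and simple. For graphs $G,H$, $G+H$ denotes the disjoint union and $tG$ the disjoint union of $t$ copies of $G$; $P_k$ is the path on $k$ vertices. A graph $G$ is $H$-saturated if $G$ contains no subgraph isomorphic to $H$, but $G+e$ contains a subgraph isomorphic to $H$ for every edge $e$ of the complement of $G$. *)

theory Defs
  imports Complex_Main
begin

text \<open>
  Undirected graphs with explicit vertex and edge sets; an edge is a two-element set of vertices.
  The datatype carries no constraint of its own: finiteness and simplicity are expressed by
  \<open>simple_graph\<close>.
\<close>

datatype 'a ugraph = UGraph (verts: "'a set") (edges: "'a set set")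

definition simple_graph :: "'a ugraph \<Rightarrow> bool" where
  "simple_graph G \<longleftrightarrow> finite (verts G) \<and> (\<forall>e\<in>edges G. e \<subseteq> verts G \<and> card e = 2)"

definition subgraph :: "'a ugraph \<Rightarrow> 'a ugraph \<Rightarrow> bool" where
  "subgraph K G \<longleftrightarrow> simple_graph K \<and> verts K \<subseteq> verts G \<and> edges K \<subseteq> edges G"

definition isomorphic :: "'a ugraph \<Rightarrow> 'b ugraph \<Rightarrow> bool" where
  "isomorphic G H \<longleftrightarrow>
     (\<exists>f. bij_betw f (verts G) (verts H) \<and>
          (\<forall>u\<in>verts G. \<forall>v\<in>verts G. {u, v} \<in> edges G \<longleftrightarrow> {f u, f v} \<in> edges H))"

definition contains_copy :: "'a ugraph \<Rightarrow> 'b ugraph \<Rightarrow> bool" where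
  "contains_copy G H \<longleftrightarrow> (\<exists>K. subgraph K G \<and> isomorphic K H)"

definition complement :: "'a ugraph \<Rightarrow> 'a ugraph" where
  "complement G = UGraph (verts G) {e. e \<subseteq> verts G \<and> card e = 2 \<and> e \<notin> edges G}"

definition add_edge :: "'a ugraph \<Rightarrow> 'a set \<Rightarrow> 'a ugraph" where
  "add_edge G e = UGraph (verts G) (insert e (edges G))"

definition saturated :: "'b ugraph \<Rightarrow> 'a ugraph \<Rightarrow> bool" where
  "saturated H G \<longleftrightarrow>
     simple_graph G \<and> \<not> contains_copy G H \<and>
     (\<forall>e\<in>edges (complement G). contains_copy (add_edge G e) H)"

definition isolated :: "'a ugraph \<Rightarrow> 'a \<Rightarrow> bool" where
  "isolated G v \<longleftrightarrow> v \<in> verts G \<and> (\<forall>e\<in>edges G. v \<notin> e)"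

definition disjoint_union :: "'a ugraph \<Rightarrow> 'b ugraph \<Rightarrow> ('a + 'b) ugraph" where
  "disjoint_union G H =
     UGraph (verts G <+> verts H) ((`) Inl ` edges G \<union> (`) Inr ` edges H)"

definition copies :: "nat \<Rightarrow> 'a ugraph \<Rightarrow> (nat \<times> 'a) ugraph" where
  "copies t G = UGraph ({..<t} \<times> verts G) {Pair i ` e | i e. i < t \<and> e \<in> edges G}"

text \<open>The index is the number of vertices, not the number of edges.\<close>

definition path_graph :: "nat \<Rightarrow> nat ugraph" where
  "path_graph k = UGraph {..<k} {{i, Suc i} | i. Suc i < k}"

text \<open>Unlike \<open>Min\<close> or \<open>Least\<close>, this also asserts that the minimum is attained.\<close>

definition is_minimum :: "nat set \<Rightarrow> nat \<Rightarrow> bool" where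
  "is_minimum S m \<longleftrightarrow> m \<in> S \<and> (\<forall>k\<in>S. m \<le> k)"

text \<open>
  Vertices are natural numbers; this is no restriction, since every finite graph is isomorphic
  to one whose vertex set is a set of natural numbers.
\<close>

definition saturated_edge_counts :: "'b ugraph \<Rightarrow> nat \<Rightarrow> nat set" where
  "saturated_edge_counts H n =
     {card (edges G) | G :: nat ugraph.
        saturated H G \<and> card (verts G) = n \<and> (\<nexists>v. isolated G v)}"

end

theory Submission
  imports Defs
begin

text \<open>
  Lower bound. A graph with \<open>\<tau>\<close> tree components has at least \<open>n - \<tau>\<close> edges, so it suffices that
  \<open>10 \<tau> \<le> n\<close>. If \<open>G\<close> contains a \<open>P\<^sub>6\<close>, then \<open>n \<ge> 10 t / 3 + 10\<close> reduces this to \<open>3 \<tau> \<le> t + 3\<close>: an edge added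
  at a vertex of a minimum vertex cover does not increase the matching number, so (by Koenig's theorem) no
  tree component has matching number 2 and at most one is a star, while a tree component containing \<open>P\<^sub>6\<close>
  contains \<open>P\<^sub>6 + P\<^sub>2\<close>; many trees would therefore provide a \<open>P\<^sub>6\<close> with \<open>t\<close> further matching edges. If \<open>G\<close> has no
  \<open>P\<^sub>6\<close>, every added edge creates one; then a tree component has no vertex of degree 2 and either no inner
  vertex or at least four of them (the middle of the new path), which makes it a \<open>K\<^sub>2\<close> or gives it at least
  10 vertices. A \<open>K\<^sub>2\<close> excludes all other trees, because every vertex outside it must be the end of a \<open>P\<^sub>4\<close>.

  Upper bound. Take \<open>\<lfloor>n / 10\<rfloor>\<close> trees of depth two in which every root has at least three children and every
  child at least two leaves. Each added edge creates a \<open>P\<^sub>6\<close> that meets at most three of the stars formed by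
  a child and its leaves, and at least \<open>t\<close> stars remain.
\<close>

section \<open>Copies of linear forests, matchings and covers\<close>

definition is_path :: "'a set set \<Rightarrow> 'a list \<Rightarrow> bool" where
  "is_path E p \<longleftrightarrow> distinct p \<and> successively (\<lambda>x y. {x, y} \<in> E) p"

definition matching :: "'a set set \<Rightarrow> bool" where
  "matching M \<longleftrightarrow> pairwise disjnt M"

text \<open>A copy of \<open>P_6 + tP_2\<close> given by its edges alone; no vertex set is needed
  because the pattern has no isolated vertices. For \<open>t = 0\<close> it is a bare path on six
  vertices.\<close>

definition P6_plus :: "'a set set \<Rightarrow> nat \<Rightarrow> bool" where
  "P6_plus E t \<longleftrightarrow>
     (\<exists>p M. is_path E p \<and> length p = 6 \<and> M \<subseteq> E \<and> finite M \<and> matching M \<and> card M = t \<and>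
            (\<forall>e\<in>M. e \<inter> set p = {}))"

lemma P6_plusI:
  assumes "is_path E p" "length p = 6" "M \<subseteq> E" "finite M" "matching M" "card M = t"
    "\<And>e. e \<in> M \<Longrightarrow> e \<inter> set p = {}"
  shows "P6_plus E t"
  unfolding P6_plus_def using assms by (intro exI[of _ p] exI[of _ M]) simp

lemma P6_plusE:
  assumes "P6_plus E t"
  obtains p M where "is_path E p" "length p = 6" "M \<subseteq> E" "finite M" "matching M" "card M = t"
    "\<forall>e\<in>M. e \<inter> set p = {}"
  using assms unfolding P6_plus_def by (elim exE conjE)

lemma matching_subset: "matching M \<Longrightarrow> N \<subseteq> M \<Longrightarrow> matching N"
  unfolding matching_def by (rule pairwise_subset)

text \<open>Subgraphs need not be induced, so a copy is just the image of \<open>H\<close> under an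
  injective map that preserves edges; non-edges of \<open>H\<close> impose nothing on
  \<open>G\<close>.\<close>

lemma contains_copy_iff_embedding:
  assumes "simple_graph H" and "simple_graph G"
  shows "contains_copy G H \<longleftrightarrow>
    (\<exists>g. inj_on g (verts H) \<and> g ` verts H \<subseteq> verts G \<and> (\<forall>e\<in>edges H. g ` e \<in> edges G))"
    (is "_ \<longleftrightarrow> (\<exists>g. ?emb g)")
proof
  assume "contains_copy G H"
  then obtain K f where K: "subgraph K G" and f: "bij_betw f (verts K) (verts H)"
    and fe: "\<And>u v. u \<in> verts K \<Longrightarrow> v \<in> verts K \<Longrightarrow> {u, v} \<in> edges K \<longleftrightarrow> {f u, f v} \<in> edges H"
    unfolding contains_copy_def isomorphic_def by blast
  define g where "g = inv_into (verts K) f"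
  have g: "bij_betw g (verts H) (verts K)"
    unfolding g_def by (rule bij_betw_inv_into[OF f])
  have fg: "f (g y) = y" if "y \<in> verts H" for y
    using that f unfolding g_def bij_betw_def by (metis f_inv_into_f)
  have "g ` e \<in> edges G" if e: "e \<in> edges H" for e
  proof -
    have "e \<subseteq> verts H" "card e = 2" using assms(1) e by (auto simp: simple_graph_def)
    then obtain a b where ab: "e = {a, b}" "a \<in> verts H" "b \<in> verts H"
      by (auto simp: card_2_iff)
    have "g a \<in> verts K" "g b \<in> verts K" using g ab by (auto simp: bij_betw_def)
    then have "{g a, g b} \<in> edges K" using fe[of "g a" "g b"] fg ab e by simp
    then show ?thesis using K ab by (auto simp: subgraph_def)
  qed
  then have "?emb g" using g K by (auto simp: bij_betw_def subgraph_def)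
  then show "\<exists>g. ?emb g" by blast
next
  assume "\<exists>g. ?emb g"
  then obtain g where g: "?emb g" by blast
  \<comment> \<open>Only images of edges of \<open>H\<close> are kept, so the inverse of
    \<open>g\<close> is an isomorphism even if \<open>G\<close> has further edges on these
    vertices.\<close>
  define K where "K = UGraph (g ` verts H) ((`) g ` edges H)"
  have vK: "verts K = g ` verts H" and eK: "edges K = (`) g ` edges H" by (simp_all add: K_def)
  have "finite (verts K)" using assms(1) by (auto simp: vK simple_graph_def)
  moreover have "e \<subseteq> verts K \<and> card e = 2" if "e \<in> edges K" for e
  proof -
    obtain e' where "e' \<in> edges H" "e = g ` e'" using \<open>e \<in> edges K\<close> by (auto simp: eK)
    then show ?thesis using assms g unfolding vK simple_graph_def by blast
  qed
  ultimately have "subgraph K G" using g unfolding subgraph_def simple_graph_def by (auto simp: vK eK)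
  moreover have "isomorphic K H"
    unfolding isomorphic_def
  proof (intro exI conjI ballI)
    show "bij_betw (inv_into (verts H) g) (verts K) (verts H)"
      using g by (auto simp: vK intro: bij_betw_inv_into simp: bij_betw_def[of g])
    fix u v assume "u \<in> verts K" "v \<in> verts K"
    then obtain a b where ab: "u = g a" "v = g b" "a \<in> verts H" "b \<in> verts H" by (auto simp: vK)
    have "{g a, g b} \<in> (`) g ` edges H \<longleftrightarrow> {a, b} \<in> edges H"
    proof
      assume "{g a, g b} \<in> (`) g ` edges H"
      then obtain e where e: "e \<in> edges H" "g ` e = g ` {a, b}" by auto
      then have "e = {a, b}"
        using inj_on_image_eq_iff[of g "verts H" e "{a, b}"] g ab assms(1)
        by (auto simp: simple_graph_def)
      then show "{a, b} \<in> edges H" using e by simp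
    next
      assume "{a, b} \<in> edges H"
      then have "g ` {a, b} \<in> (`) g ` edges H" by (rule imageI)
      then show "{g a, g b} \<in> (`) g ` edges H" by simp
    qed
    then show "{u, v} \<in> edges K \<longleftrightarrow> {inv_into (verts H) g u, inv_into (verts H) g v} \<in> edges H"
      using g ab by (simp add: eK)
  qed
  ultimately show "contains_copy G H" unfolding contains_copy_def by blast
qed

lemma length_6_conv: "length p = 6 \<longleftrightarrow> (\<exists>a b c d e f. p = [a, b, c, d, e, f])"
  by (auto simp: numeral_eq_Suc length_Suc_conv)

abbreviation P6_tP2 :: "nat \<Rightarrow> (nat + nat \<times> nat) ugraph" where
  "P6_tP2 t \<equiv> disjoint_union (path_graph 6) (copies t (path_graph 2))"

lemma verts_P6_tP2: "verts (P6_tP2 t) = Inl ` {..<6} \<union> Inr ` ({..<t} \<times> {..<2})"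
  by (auto simp: disjoint_union_def path_graph_def copies_def)

lemma edges_P6_tP2:
  "edges (P6_tP2 t) = {{Inl i, Inl (Suc i)} | i. Suc i < 6} \<union> {{Inr (j, 0), Inr (j, 1)} | j. j < t}"
proof -
  have "(`) Inl ` {{i, Suc i} | i. Suc i < 6} = ((\<lambda>i. Inl ` {i, Suc i}) ` {i. Suc i < 6} :: (nat + nat \<times> nat) set set)"
    by blast
  also have "\<dots> = {{Inl i, Inl (Suc i)} | i. Suc i < (6::nat)}"
    by auto
  finally have "(`) Inl ` {{i, Suc i} | i. Suc i < 6} =
      ({{Inl i, Inl (Suc i)} | i. Suc i < 6} :: (nat + nat \<times> nat) set set)" .
  moreover have "{{i, Suc i} | i. Suc i < 2} = {{0, 1::nat}}"
    by (auto simp: numeral_eq_Suc)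
  then have "{Pair i ` e | i e. i < t \<and> e \<in> {{i, Suc i} | i. Suc i < 2}} =
      (\<lambda>j. {(j, 0), (j, 1)}) ` {..<t}"
    by auto
  then have "(`) Inr ` {Pair i ` e | i e. i < t \<and> e \<in> {{i, Suc i} | i. Suc i < 2}} =
      ({{Inr (j, 0), Inr (j, 1)} | j. j < t} :: (nat + nat \<times> nat) set set)"
    by (auto simp: image_image)
  ultimately show ?thesis
    by (simp add: disjoint_union_def path_graph_def copies_def)
qed

lemma simple_P6_tP2: "simple_graph (P6_tP2 t)"
  unfolding simple_graph_def
  by (auto simp: verts_P6_tP2 edges_P6_tP2)

lemma contains_P6_tP2_iff:
  assumes "simple_graph G"
  shows "contains_copy G (P6_tP2 t) \<longleftrightarrow> P6_plus (edges G) t"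
  unfolding contains_copy_iff_embedding[OF simple_P6_tP2 assms]
proof
  assume "\<exists>g. inj_on g (verts (P6_tP2 t)) \<and> g ` verts (P6_tP2 t) \<subseteq> verts G \<and>
             (\<forall>e\<in>edges (P6_tP2 t). g ` e \<in> edges G)"
  then obtain g where inj: "inj_on g (verts (P6_tP2 t))"
    and e: "\<And>e. e \<in> edges (P6_tP2 t) \<Longrightarrow> g ` e \<in> edges G" by blast
  define p where "p = map (\<lambda>i. g (Inl i)) [0..<6]"
  define m where "m j = {g (Inr (j, 0)), g (Inr (j, 1))}" for j
  have inj': "g x = g y \<longleftrightarrow> x = y" if "x \<in> verts (P6_tP2 t)" "y \<in> verts (P6_tP2 t)" for x y
    using inj that by (auto simp: inj_on_def)
  have edge_p: "{g (Inl i), g (Inl (Suc i))} \<in> edges G" if "Suc i < 6" for i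
    using e[of "{Inl i, Inl (Suc i)}"] that by (auto simp: edges_P6_tP2)
  have edge_m: "m j \<in> edges G" if "j < t" for j
    using e[of "{Inr (j, 0), Inr (j, 1)}"] that by (auto simp: edges_P6_tP2 m_def)
  have "distinct p" by (auto simp: p_def distinct_map inj_on_def inj' verts_P6_tP2)
  moreover have "successively (\<lambda>x y. {x, y} \<in> edges G) p"
    using edge_p by (auto simp: p_def successively_conv_nth)
  moreover have "inj_on m {..<t}"
    by (auto simp: inj_on_def m_def doubleton_eq_iff inj' verts_P6_tP2)
  moreover have "matching (m ` {..<t})"
    by (auto simp: matching_def pairwise_def disjnt_def m_def inj' verts_P6_tP2)
  moreover have "\<forall>e\<in>m ` {..<t}. e \<inter> set p = {}"
    by (auto simp: p_def m_def inj' verts_P6_tP2)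
  ultimately show "P6_plus (edges G) t"
    using edge_m by (intro P6_plusI[of _ p "m ` {..<t}"]) (auto simp: is_path_def card_image p_def)
next
  have E: "e \<subseteq> verts G \<and> card e = 2" if "e \<in> edges G" for e
    using assms that by (simp add: simple_graph_def)
  assume "P6_plus (edges G) t"
  then obtain p M where p: "is_path (edges G) p" "length p = 6"
    and M: "M \<subseteq> edges G" "finite M" "matching M" "card M = t" and pM: "\<And>e. e \<in> M \<Longrightarrow> e \<inter> set p = {}"
    unfolding P6_plus_def by blast
  obtain h where h: "bij_betw h {..<t} M"
    using ex_bij_betw_nat_finite[OF M(2)] M(4) by (auto simp: atLeast0LessThan)
  have hM: "h j \<in> M" if "j < t" for j using h that by (auto simp: bij_betw_def)
  have "\<exists>a b. h j = {a, b} \<and> a \<noteq> b" if "j < t" for j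
    using hM[OF that] M(1) E by (meson card_2_iff subsetD)
  \<comment> \<open>Numbering the matching edges by \<open>h\<close> and ordering the two ends of
    each gives the images of the copies of \<open>P_2\<close>.\<close>
  then obtain a b where ab: "\<And>j. j < t \<Longrightarrow> h j = {a j, b j} \<and> a j \<noteq> b j" by metis
  have hd: "h i \<inter> h j = {}" if "i < t" "j < t" "i \<noteq> j" for i j
    using M(3) hM that h unfolding matching_def pairwise_def disjnt_def bij_betw_def
    by (metis inj_onD lessThan_iff)
  define c where "c j k = (if k = 0 then a j else b j)" for j and k :: nat
  define g where "g = case_sum ((!) p) (\<lambda>(j, k). c j k)"
  have c_in: "c j k \<in> h j" if "j < t" for j k using ab[OF that] by (auto simp: c_def)
  have c_p: "c j k \<noteq> p ! i" if "j < t" "i < 6" for i j k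
    using c_in[OF that(1), of k] pM[OF hM[OF that(1)]] p(2) that(2) by (metis disjoint_iff nth_mem)
  have c_c: "c i k = c j l \<longleftrightarrow> i = j \<and> k = l" if "i < t" "j < t" "k < 2" "l < 2" for i j k l
  proof (cases "i = j")
    case True
    then show ?thesis using ab[of j] that by (auto simp: c_def less_2_cases_iff)
  next
    case False
    then show ?thesis using hd[of i j] c_in[of i k] c_in[of j l] that by auto
  qed
  have p_p: "p ! i = p ! j \<longleftrightarrow> i = j" if "i < 6" "j < 6" for i j
    using p that by (auto simp: is_path_def nth_eq_iff_index_eq)
  have "inj_on g (verts (P6_tP2 t))"
    unfolding verts_P6_tP2
  proof (rule inj_onI)
    fix x y :: "nat + nat \<times> nat"
    assume "x \<in> Inl ` {..<6} \<union> Inr ` ({..<t} \<times> {..<2})" "y \<in> Inl ` {..<6} \<union> Inr ` ({..<t} \<times> {..<2})"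
      and "g x = g y"
    then show "x = y"
      by (elim UnE imageE; clarsimp simp: g_def c_c p_p c_p c_p[THEN not_sym])
  qed
  moreover have edges: "g ` e \<in> edges G" if "e \<in> edges (P6_tP2 t)" for e
  proof -
    consider i where "Suc i < 6" "e = {Inl i, Inl (Suc i)}" | j where "j < t" "e = {Inr (j, 0), Inr (j, 1)}"
      using \<open>e \<in> edges (P6_tP2 t)\<close> unfolding edges_P6_tP2 by blast
    then show ?thesis
    proof cases
      case 1
      then show ?thesis using p by (auto simp: g_def is_path_def successively_conv_nth)
    next
      case 2
      then show ?thesis using ab[of j] hM[of j] M(1) by (auto simp: g_def c_def)
    qed
  qed
  moreover have "g ` verts (P6_tP2 t) \<subseteq> verts G"
  proof -
    have "p ! i \<in> verts G" if "i < 6" for i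
    proof -
      \<comment> \<open>The last vertex of the path starts no path edge, so it is treated as the end
        of the preceding one.\<close>
      have "\<exists>j k. (i = j \<or> i = k) \<and> k < 6 \<and> k = Suc j"
        using that by (cases i) auto
      then obtain j where "i = j \<or> i = Suc j" "Suc j < 6" by blast
      moreover from this have "{p ! j, p ! Suc j} \<in> edges G"
        using p by (auto simp: is_path_def successively_conv_nth)
      ultimately show ?thesis using E by auto
    qed
    moreover have "c j k \<in> verts G" if "j < t" for j k
      using c_in[OF that] hM[OF that] M(1) E by blast
    ultimately show ?thesis by (auto simp: verts_P6_tP2 g_def)
  qed
  ultimately show "\<exists>g. inj_on g (verts (P6_tP2 t)) \<and> g ` verts (P6_tP2 t) \<subseteq> verts G \<and>
      (\<forall>e\<in>edges (P6_tP2 t). g ` e \<in> edges G)" by blast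
qed

section \<open>Vertex covers, forests and paths\<close>

definition covers :: "'a set \<Rightarrow> 'a set set \<Rightarrow> bool" where
  "covers K E \<longleftrightarrow> (\<forall>e\<in>E. e \<inter> K \<noteq> {})"

definition nbrs :: "'a set set \<Rightarrow> 'a \<Rightarrow> 'a set" where
  "nbrs E v = {w. {v, w} \<in> E}"

definition deg :: "'a set set \<Rightarrow> 'a \<Rightarrow> nat" where
  "deg E v = card {e \<in> E. v \<in> e}"

text \<open>For finite \<open>E\<close> this says that there is no cycle.\<close>

definition forest :: "'a set set \<Rightarrow> bool" where
  "forest E \<longleftrightarrow> (\<forall>F\<subseteq>E. F \<noteq> {} \<longrightarrow> (\<exists>v. deg F v = 1))"

lemma path_simps [simp]:
  "is_path E []"
  "is_path E [x]"
  "is_path E (x # y # p) \<longleftrightarrow> {x, y} \<in> E \<and> x \<notin> set (y # p) \<and> is_path E (y # p)"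
  by (auto simp: is_path_def)

lemma path_append:
  "is_path E (p @ q) \<longleftrightarrow> is_path E p \<and> is_path E q \<and> set p \<inter> set q = {} \<and>
     (p = [] \<or> q = [] \<or> {last p, hd q} \<in> E)"
  by (auto simp: is_path_def successively_append_iff)

lemma path_rev [simp]: "is_path E (rev p) \<longleftrightarrow> is_path E p"
  by (simp add: is_path_def successively_rev insert_commute)

lemma path_mono: "is_path E p \<Longrightarrow> E \<subseteq> E' \<Longrightarrow> is_path E' p"
  unfolding is_path_def by (auto elim!: successively_mono)

lemma path_6I:
  assumes "is_path E p" "length p \<ge> 6" shows "P6_plus E 0"
proof -
  have "is_path E (take 6 p)" using assms(1) path_append[of E "take 6 p" "drop 6 p"] by simp
  moreover have "length (take 6 p) = 6" using assms(2) by simp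
  ultimately show ?thesis unfolding P6_plus_def matching_def
    by (intro exI[of _ "take 6 p"] exI[of _ "{}"]) simp
qed

lemma P6_plus_less:
  assumes "P6_plus E t" "s \<le> t" shows "P6_plus E s"
proof -
  obtain p M where pM: "is_path E p" "length p = 6" "M \<subseteq> E" "finite M" "matching M" "card M = t"
    "\<forall>e\<in>M. e \<inter> set p = {}" using assms(1) unfolding P6_plus_def by blast
  obtain M' where M': "M' \<subseteq> M" "card M' = s" using assms(2) pM(6) obtain_subset_with_card_n by blast
  have "matching M'" using pM(5) M'(1) unfolding matching_def by (rule pairwise_subset)
  then show ?thesis unfolding P6_plus_def using pM M' finite_subset[OF M'(1) pM(4)]
    by (intro exI[of _ p] exI[of _ M']) auto
qed

text \<open>Choosing a cover vertex in every edge is injective because the edges are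
  disjoint.\<close>

lemma matching_cover:
  assumes "matching M" "covers K M" "finite K"
  shows "finite M" "card M \<le> card K"
proof -
  have "\<forall>e\<in>M. \<exists>x. x \<in> e \<inter> K" using assms(2) unfolding covers_def by blast
  then obtain f where f: "\<And>e. e \<in> M \<Longrightarrow> f e \<in> e \<inter> K" by (metis bchoice)
  have inj: "inj_on f M"
  proof (rule inj_onI)
    fix x y assume "x \<in> M" "y \<in> M" "f x = f y"
    then show "x = y" using f[of x] f[of y] assms(1) unfolding matching_def pairwise_def disjnt_def by (metis IntE disjoint_iff)
  qed
  have "f ` M \<subseteq> K" using f by auto
  then show "finite M" "card M \<le> card K"
    using inj assms(3) by (auto intro: inj_on_finite card_inj_on_le)
qed

text \<open>The first, third and fifth edge of the path extend the \<open>j\<close> further edges to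
  a matching of size \<open>j + 3\<close>.\<close>

lemma P6_cover:
  assumes "P6_plus E j" "covers K E" "finite K"
  shows "j + 3 \<le> card K"
proof -
  obtain p M where p: "is_path E p" "length p = 6" and M: "M \<subseteq> E" "finite M" "matching M" "card M = j"
    and disj: "\<forall>e\<in>M. e \<inter> set p = {}"
    using assms(1) unfolding P6_plus_def by blast
  obtain a b c d e f where p_eq: "p = [a, b, c, d, e, f]" using p(2) by (auto simp: length_6_conv)
  let ?N = "{{a, b}, {c, d}, {e, f}}"
  have path: "{a, b} \<in> E" "{c, d} \<in> E" "{e, f} \<in> E" "distinct [a, b, c, d, e, f]"
    using p(1) unfolding p_eq by auto
  have M_disj: "g \<inter> {a, b} = {} \<and> g \<inter> {c, d} = {} \<and> g \<inter> {e, f} = {}" if "g \<in> M" for g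
    using disj that unfolding p_eq by auto
  have "?N \<inter> M = {}" using M_disj by blast
  moreover have "card ?N = 3" using path(4) by (simp add: doubleton_eq_iff)
  ultimately have "card (?N \<union> M) = j + 3" using M(2,4) card_Un_disjoint[of ?N M] by simp
  moreover have "matching (?N \<union> M)"
  proof -
    have "e \<inter> f = {}" if "e \<in> ?N" "f \<in> ?N" "e \<noteq> f" for e f
      using that path(4) by auto
    moreover have "e \<inter> f = {}" if "e \<in> ?N" "f \<in> M" for e f
      using that M_disj[of f] by blast
    moreover have "e \<inter> f = {}" if "e \<in> M" "f \<in> M" "e \<noteq> f" for e f
      using that M(3) by (auto simp: matching_def pairwise_def disjnt_def)
    ultimately show ?thesis
      unfolding matching_def pairwise_def disjnt_def by (metis Un_iff inf_commute)
  qed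
  moreover have "covers K (?N \<union> M)" using assms(2) M(1) path(1-3) unfolding covers_def by blast
  ultimately show ?thesis using matching_cover(2)[of "?N \<union> M" K] assms(3) by simp
qed

lemma deg_eq_card_nbrs:
  assumes "\<And>e. e \<in> E \<Longrightarrow> card e = 2"
  shows "deg E v = card (nbrs E v)"
proof -
  have "bij_betw (\<lambda>w. {v, w}) (nbrs E v) {e \<in> E. v \<in> e}"
  proof (rule bij_betw_imageI)
    show "inj_on (\<lambda>w. {v, w}) (nbrs E v)" by (auto simp: inj_on_def doubleton_eq_iff)
    show "(\<lambda>w. {v, w}) ` nbrs E v = {e \<in> E. v \<in> e}"
    proof
      show "{e \<in> E. v \<in> e} \<subseteq> (\<lambda>w. {v, w}) ` nbrs E v"
      proof
        fix e assume e: "e \<in> {e \<in> E. v \<in> e}"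
        then obtain x y where "e = {x, y}" using assms[of e] by (auto simp: card_2_iff)
        then show "e \<in> (\<lambda>w. {v, w}) ` nbrs E v" using e by (auto simp: nbrs_def insert_commute)
      qed
    qed (auto simp: nbrs_def)
  qed
  then show ?thesis unfolding deg_def using bij_betw_same_card by metis
qed

lemma handshake:
  assumes "finite A" "finite F" "\<And>e. e \<in> F \<Longrightarrow> e \<subseteq> A \<and> card e = 2"
  shows "(\<Sum>v\<in>A. deg F v) = 2 * card F"
proof -
  have "(\<Sum>v\<in>A. deg F v) = (\<Sum>v\<in>A. \<Sum>e\<in>F. if v \<in> e then 1 else 0)"
    unfolding deg_def using assms(2) by (simp add: sum.If_cases Int_def)
  also have "\<dots> = (\<Sum>e\<in>F. \<Sum>v\<in>A. if v \<in> e then 1 else 0)" by (rule sum.swap)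
  also have "\<dots> = (\<Sum>e\<in>F. 2)"
  proof (rule sum.cong)
    fix e assume "e \<in> F"
    then have "A \<inter> e = e" "card e = 2" using assms(3) by auto
    then show "(\<Sum>v\<in>A. if v \<in> e then 1 else 0) = (2::nat)"
      using assms(1) by (simp add: sum.If_cases)
  qed simp
  finally show ?thesis by simp
qed

lemma forest_mono: "forest E \<Longrightarrow> F \<subseteq> E \<Longrightarrow> forest F"
  unfolding forest_def by blast

text \<open>In the edge set of a closed cycle, a vertex of degree one would have equal predecessor
  and successor, which is impossible for length at least three.\<close>

lemma forest_no_cycle:
  assumes "forest E" "is_path E p" "length p \<ge> 3" "{hd p, last p} \<in> E"
  shows False
proof -
  define k where "k = length p"
  \<comment> \<open>The cyclic successor of a position, which makes \<open>F\<close> the edge set of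
    the closed cycle.\<close>
  define n where "n i = (if Suc i = k then 0 else Suc i)" for i
  define F where "F = (\<lambda>i. {p ! i, p ! n i}) ` {..<k}"
  have k: "k \<ge> 3" "p \<noteq> []" using assms(3) by (auto simp: k_def)
  have "F \<subseteq> E"
  proof
    fix e assume "e \<in> F"
    then obtain i where i: "i < k" "e = {p ! i, p ! n i}" by (auto simp: F_def)
    show "e \<in> E"
    proof (cases "Suc i = k")
      case True
      then have "i = length p - 1" by (simp add: k_def)
      then show ?thesis using assms(4) i True k by (simp add: n_def hd_conv_nth last_conv_nth insert_commute)
    next
      case False
      then show ?thesis using assms(2) i by (simp add: n_def is_path_def successively_conv_nth k_def)
    qed
  qed
  moreover have "F \<noteq> {}" using k by (simp add: F_def lessThan_empty_iff)
  ultimately obtain v where v: "deg F v = 1" using assms(1) by (auto simp: forest_def)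
  then obtain e0 where e0: "{e \<in> F. v \<in> e} = {e0}" unfolding deg_def using card_1_singletonE by blast
  then have "e0 \<in> F" "v \<in> e0" by auto
  have n_less: "n i < k" if "i < k" for i using that by (auto simp: n_def)
  have "\<exists>j<k. v = p ! j" using \<open>e0 \<in> F\<close> \<open>v \<in> e0\<close> n_less by (auto simp: F_def)
  then obtain j where j: "j < k" "v = p ! j" by blast
  obtain i where i: "i < k" "n i = j"
  proof (cases j)
    case 0
    then show ?thesis using k that[of "k - 1"] by (auto simp: n_def)
  next
    case (Suc i)
    then show ?thesis using j that[of i] by (auto simp: n_def)
  qed
  have "{p ! j, p ! n j} \<in> {e \<in> F. v \<in> e}" "{p ! i, p ! n i} \<in> {e \<in> F. v \<in> e}"
    using i j by (auto simp: F_def)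
  then have "{p ! j, p ! n j} = {p ! i, p ! j}" using e0 i by auto
  then have "p ! n j = p ! i" by (auto simp: doubleton_eq_iff)
  then have "n j = i" using assms(2) n_less[OF j(1)] i(1)
    by (simp add: is_path_def nth_eq_iff_index_eq k_def)
  then show False using i j k by (auto simp: n_def split: if_splits)
qed

text \<open>Koenig's theorem for forests by leaf removal: if \<open>v\<close> is the only neighbour
  of \<open>u\<close>, put \<open>v\<close> into the cover and \<open>uv\<close> into the matching,
  and recurse on the edges avoiding \<open>v\<close>; these avoid \<open>u\<close> as well.\<close>

lemma forest_konig:
  assumes "finite E" "\<And>e. e \<in> E \<Longrightarrow> card e = 2" "forest E"
  obtains K M where "finite K" "K \<subseteq> \<Union>E" "covers K E" "M \<subseteq> E" "matching M" "card M = card K"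
proof -
  have "\<exists>K M. finite K \<and> K \<subseteq> \<Union>E \<and> covers K E \<and> M \<subseteq> E \<and> matching M \<and> card M = card K"
    using assms
  proof (induction "card E" arbitrary: E rule: less_induct)
    case less
    show ?case
    proof (cases "E = {}")
      case True
      then show ?thesis by (intro exI[of _ "{}"]) (auto simp: covers_def matching_def)
    next
      case False
      then obtain u where "deg E u = 1" using less.prems(3) unfolding forest_def by blast
      then obtain e0 where e0: "{e \<in> E. u \<in> e} = {e0}" unfolding deg_def using card_1_singletonE by blast
      then have e0E: "e0 \<in> E" "u \<in> e0" by auto
      then obtain v where v: "e0 = {u, v}" "u \<noteq> v"
        using less.prems(2)[OF e0E(1)] by (auto simp: card_2_iff doubleton_eq_iff)
      define E' where "E' = {e \<in> E. v \<notin> e}"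
      have "E' \<subset> E" using e0E v by (auto simp: E'_def)
      then have "card E' < card E" using less.prems(1) by (simp add: psubset_card_mono)
      then obtain K M where KM: "finite K" "K \<subseteq> \<Union>E'" "covers K E'" "M \<subseteq> E'" "matching M" "card M = card K"
        using less.hyps[of E'] less.prems \<open>E' \<subset> E\<close> forest_mono[of E E'] finite_subset[of E' E] by (auto simp: E'_def)
      have uE': "u \<notin> e" if "e \<in> E'" for e
        using that e0 v by (auto simp: E'_def)
      have "v \<notin> K" using KM(2) by (auto simp: E'_def)
      have "e0 \<notin> M" using KM(4) v by (auto simp: E'_def)
      have "finite M" using KM(3,4) by (intro matching_cover(1)[OF KM(5) _ KM(1)]) (auto simp: covers_def)
      have "matching (insert e0 M)"
        using KM(4,5) v uE' unfolding matching_def pairwise_insert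
        by (auto simp: disjnt_def E'_def)
      moreover have "card (insert e0 M) = card (insert v K)"
        using KM(1,6) \<open>e0 \<notin> M\<close> \<open>v \<notin> K\<close> \<open>finite M\<close> by simp
      moreover have "covers (insert v K) E" using KM(3) by (auto simp: covers_def E'_def)
      moreover have "insert v K \<subseteq> \<Union>E" using KM(2) e0E v by (auto simp: E'_def)
      moreover have "insert e0 M \<subseteq> E" using KM(4) e0E by (auto simp: E'_def)
      ultimately show ?thesis using KM(1)
        by (intro exI[of _ "insert v K"] exI[of _ "insert e0 M"]) simp
    qed
  qed
  then show ?thesis using that by blast
qed

text \<open>The path must use \<open>xy\<close>, and only once because its vertices are distinct.
  Reversing it if necessary puts \<open>x\<close> first, and both pieces are old paths.\<close>

lemma new_edge_path:
  assumes "is_path (insert {x, y} E) p" "\<not> is_path E p"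
  obtains xs ys where "is_path (insert {x, y} E) (xs @ x # y # ys)" "is_path E (xs @ [x])" "is_path E (y # ys)"
    "length p = length xs + length ys + 2"
proof -
  note that_path = that
  have "\<exists>i. Suc i < length p \<and> {p ! i, p ! Suc i} = {x, y}"
    using assms unfolding is_path_def successively_conv_nth by blast
  then obtain i where i: "Suc i < length p" "{p ! i, p ! Suc i} = {x, y}" by blast
  have *: thesis if q: "is_path (insert {x, y} E) q" "q = xs @ x # y # ys" "length q = length p" for q xs ys
  proof -
    have d: "distinct (xs @ x # y # ys)" using q by (simp add: is_path_def)
    have succ: "successively (\<lambda>u v. {u, v} \<in> insert {x, y} E) (xs @ [x])"
      "successively (\<lambda>u v. {u, v} \<in> insert {x, y} E) (y # ys)"
      using q by (auto simp: is_path_def successively_append_iff)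
    have "successively (\<lambda>u v. {u, v} \<in> E) (xs @ [x])"
      by (rule successively_mono[OF succ(1)]) (use d in \<open>auto simp: doubleton_eq_iff\<close>)
    moreover have "successively (\<lambda>u v. {u, v} \<in> E) (y # ys)"
      by (rule successively_mono[OF succ(2)]) (use d in \<open>auto simp: doubleton_eq_iff\<close>)
    ultimately show thesis using q d by (intro that_path[of xs ys]) (auto simp: is_path_def)
  qed
  have p: "p = take i p @ p ! i # p ! Suc i # drop (Suc (Suc i)) p"
    using i(1) by (metis Cons_nth_drop_Suc Suc_lessD append_take_drop_id)
  from i(2) consider "p ! i = x" "p ! Suc i = y" | "p ! i = y" "p ! Suc i = x"
    by (auto simp: doubleton_eq_iff)
  then show thesis
  proof cases
    case 1
    then show ?thesis using *[OF assms(1)] p by simp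
  next
    case 2
    have eq: "rev p = rev (drop (Suc (Suc i)) p) @ x # y # rev (take i p)"
      using arg_cong[OF p, of rev] 2 by simp
    show ?thesis by (rule *[OF _ eq]) (simp_all only: path_rev assms(1) length_rev)
  qed
qed

lemma path_closed:
  assumes "is_path F p" "\<And>e. e \<in> F \<Longrightarrow> e \<inter> U \<noteq> {} \<Longrightarrow> e \<subseteq> U" "set p \<inter> U \<noteq> {}"
  shows "set p \<subseteq> U"
  using assms
proof (induction p rule: induct_list012)
  case (3 x y p)
  have "{x, y} \<in> F" using "3.prems"(1) by simp
  then have "x \<in> U \<longleftrightarrow> y \<in> U" using "3.prems"(2)[of "{x, y}"] by auto
  then show ?case using "3.IH"(2) "3.prems" by auto
qed auto

lemma path_restrict:
  assumes "is_path F p" "length p \<ge> 2" "set p \<subseteq> U" shows "is_path {e \<in> F. e \<subseteq> U} p"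
  using assms unfolding is_path_def by (auto elim!: successively_mono)

text \<open>A chord would close the segment of the path between its ends to a cycle.\<close>

lemma forest_path_chord:
  assumes "forest E" "is_path E p" "i < j" "j < length p" "{p ! i, p ! j} \<in> E"
  shows "j = Suc i"
proof (rule ccontr)
  assume "j \<noteq> Suc i"
  define q where "q = take (Suc (j - i)) (drop i p)"
  have "is_path E (drop i p)" using assms(2) path_append[of E "take i p" "drop i p"] by simp
  then have "is_path E q"
    using path_append[of E q "drop (Suc (j - i)) (drop i p)"] by (simp add: q_def del: drop_drop)
  moreover have len: "length q = Suc (j - i)" using assms(3,4) by (simp add: q_def)
  moreover have "3 \<le> length q" using len assms(3) \<open>j \<noteq> Suc i\<close> by simp
  moreover have "hd q = p ! i" "last q = p ! j"
    using len assms(3,4) by (simp_all add: hd_conv_nth last_conv_nth q_def)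
  ultimately show False using forest_no_cycle[OF assms(1), of q] assms(5) by simp
qed

lemma forest_path_edge:
  assumes "forest E" "is_path E p" "{u, v} \<in> E" "u \<in> set p" "v \<in> set p" "u \<noteq> v"
  obtains i where "Suc i < length p" "{u, v} = {p ! i, p ! Suc i}"
proof -
  obtain i j where ij: "i < length p" "u = p ! i" "j < length p" "v = p ! j"
    using assms(4,5) by (auto simp: in_set_conv_nth)
  then consider "i < j" | "j < i" using assms(6) by (metis linorder_neqE_nat)
  then show thesis
  proof cases
    case 1
    then show ?thesis using forest_path_chord[OF assms(1,2)] assms(3) ij that[of i] by blast
  next
    case 2
    then show ?thesis using forest_path_chord[OF assms(1,2) 2] assms(3) ij that[of j] by (simp add: insert_commute)
  qed
qed

section \<open>Saturated graphs without isolated vertices\<close>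

locale saturated_graph =
  fixes V :: "'a set" and E :: "'a set set" and t :: nat
  assumes finV: "finite V"
    and edge: "e \<in> E \<Longrightarrow> e \<subseteq> V \<and> card e = 2"
    and no_copy: "\<not> P6_plus E t"
    and sat: "\<lbrakk>x \<in> V; y \<in> V; x \<noteq> y; {x, y} \<notin> E\<rbrakk> \<Longrightarrow> P6_plus (insert {x, y} E) t"
    and no_isolated: "x \<in> V \<Longrightarrow> \<exists>e\<in>E. x \<in> e"
begin

section \<open>Closed vertex sets and components\<close>

text \<open>These are the unions of connected components. Taking components as the minimal nonempty
  ones avoids any notion of walk.\<close>

definition adj_closed :: "'a set \<Rightarrow> bool" where
  "adj_closed U \<longleftrightarrow> U \<subseteq> V \<and> (\<forall>e\<in>E. e \<inter> U \<noteq> {} \<longrightarrow> e \<subseteq> U)"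

definition inner_edges :: "'a set \<Rightarrow> 'a set set" where
  "inner_edges U = {e \<in> E. e \<subseteq> U}"

definition component :: "'a set \<Rightarrow> bool" where
  "component C \<longleftrightarrow> adj_closed C \<and> C \<noteq> {} \<and> (\<forall>S. adj_closed S \<and> S \<noteq> {} \<and> S \<subseteq> C \<longrightarrow> S = C)"

text \<open>Components are connected, so the edge count characterises trees; acyclicity is derived
  in \<open>tree_forest\<close>.\<close>

definition tree :: "'a set \<Rightarrow> bool" where
  "tree C \<longleftrightarrow> component C \<and> Suc (card (inner_edges C)) = card C"

lemma finE: "finite E"
proof (rule finite_subset)
  show "E \<subseteq> Pow V" using edge by blast
  show "finite (Pow V)" using finV by simp
qed

lemma inner_edges_subset: "inner_edges U \<subseteq> E"
  by (auto simp: inner_edges_def)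

lemma adj_closed_finite: "adj_closed U \<Longrightarrow> finite U"
  using finV finite_subset by (auto simp: adj_closed_def)

lemma adj_closedI: "U \<subseteq> V \<Longrightarrow> (\<And>e. e \<in> E \<Longrightarrow> e \<inter> U = {} \<or> e \<subseteq> U) \<Longrightarrow> adj_closed U"
  unfolding adj_closed_def by meson

lemma adj_closedD: "adj_closed U \<Longrightarrow> e \<in> E \<Longrightarrow> e \<inter> U = {} \<or> e \<subseteq> U"
  unfolding adj_closed_def by meson

lemma
  assumes "adj_closed U" "adj_closed W"
  shows adj_closed_Un: "adj_closed (U \<union> W)"
    and adj_closed_Int: "adj_closed (U \<inter> W)"
    and adj_closed_Diff: "adj_closed (U - W)"
proof -
  have sub: "U \<subseteq> V" "W \<subseteq> V" using assms by (simp_all add: adj_closed_def)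
  have *: "e \<inter> (U \<union> W) = {} \<or> e \<subseteq> U \<union> W" "e \<inter> (U \<inter> W) = {} \<or> e \<subseteq> U \<inter> W"
    "e \<inter> (U - W) = {} \<or> e \<subseteq> U - W" if "e \<in> E" for e
    using adj_closedD[OF assms(1) that] adj_closedD[OF assms(2) that] by blast+
  show "adj_closed (U \<union> W)" by (rule adj_closedI[OF _ *(1)]) (use sub in blast)
  show "adj_closed (U \<inter> W)" by (rule adj_closedI[OF _ *(2)]) (use sub in blast)
  show "adj_closed (U - W)" by (rule adj_closedI[OF _ *(3)]) (use sub in blast)
qed

lemma edge_neq: "{x, y} \<in> E \<Longrightarrow> x \<noteq> y"
  using edge[of "{x, y}"] by auto

lemma edge_closed: "adj_closed U \<Longrightarrow> {x, y} \<in> E \<Longrightarrow> x \<in> U \<Longrightarrow> y \<in> U"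
  unfolding adj_closed_def by auto

text \<open>The component of \<open>x\<close> is the intersection of all closed sets around
  \<open>x\<close>. A proper closed part missing \<open>x\<close> could be removed from it, leaving
  a smaller closed set around \<open>x\<close>.\<close>

lemma ex_component:
  assumes "x \<in> V" obtains C where "component C" "x \<in> C"
proof -
  define C where "C = \<Inter>{U. adj_closed U \<and> x \<in> U}"
  have V: "adj_closed V" using edge by (auto simp: adj_closed_def)
  have "adj_closed C"
    unfolding adj_closed_def
  proof (intro conjI ballI impI)
    show "C \<subseteq> V" using V assms by (auto simp: C_def)
    fix e assume "e \<in> E" "e \<inter> C \<noteq> {}"
    have "e \<subseteq> U" if "adj_closed U" "x \<in> U" for U
    proof -
      have "C \<subseteq> U" using that by (auto simp: C_def)
      then show ?thesis using that(1) \<open>e \<in> E\<close> \<open>e \<inter> C \<noteq> {}\<close> unfolding adj_closed_def by blast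
    qed
    then show "e \<subseteq> C" by (auto simp: C_def)
  qed
  have "x \<in> C" by (auto simp: C_def)
  have min: "S = C" if S: "adj_closed S" "S \<noteq> {}" "S \<subseteq> C" for S
  proof (cases "x \<in> S")
    case True
    then show ?thesis using S by (auto simp: C_def)
  next
    case False
    then have "C - S \<in> {U. adj_closed U \<and> x \<in> U}"
      using adj_closed_Diff[OF \<open>adj_closed C\<close> S(1)] \<open>x \<in> C\<close> by simp
    then have "C \<subseteq> C - S" unfolding C_def[symmetric] by (subst C_def) (rule Inter_lower)
    then show ?thesis using S by blast
  qed
  have "component C"
    unfolding component_def
  proof (intro conjI allI impI)
    show "C \<noteq> {}" using \<open>x \<in> C\<close> by blast
    show "S = C" if "adj_closed S \<and> S \<noteq> {} \<and> S \<subseteq> C" for S using that by (elim conjE) (rule min)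
  qed fact
  then show thesis using \<open>x \<in> C\<close> by (rule that)
qed

lemma component_closed: "component C \<Longrightarrow> adj_closed C"
  and component_nonempty: "component C \<Longrightarrow> C \<noteq> {}"
  and component_minimal: "component C \<Longrightarrow> adj_closed S \<Longrightarrow> S \<noteq> {} \<Longrightarrow> S \<subseteq> C \<Longrightarrow> S = C"
  unfolding component_def by blast+

lemma component_disjoint:
  assumes "component C" "component D" "C \<noteq> D" shows "C \<inter> D = {}"
proof (rule ccontr)
  assume "C \<inter> D \<noteq> {}"
  have cl: "adj_closed (C \<inter> D)" 
    by (rule adj_closed_Int[OF component_closed[OF assms(1)] component_closed[OF assms(2)]])
  have "C \<inter> D = C" by (rule component_minimal[OF assms(1) cl \<open>C \<inter> D \<noteq> {}\<close> inf_le1])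
  moreover have "C \<inter> D = D" by (rule component_minimal[OF assms(2) cl \<open>C \<inter> D \<noteq> {}\<close> inf_le2])
  ultimately have "C = D" by simp
  then show False using assms(3) by simp
qed

lemma edge_inner_edges:
  assumes "e \<in> E" obtains C where "component C" "e \<in> inner_edges C"
proof -
  obtain x where "x \<in> e" using edge[OF assms] by fastforce
  then obtain C where "component C" "x \<in> C" using ex_component edge[OF assms] by blast
  then show thesis using that[of C] assms \<open>x \<in> e\<close> component_closed[of C]
    by (auto simp: adj_closed_def inner_edges_def)
qed

text \<open>Saturation localised to a union \<open>U\<close> of components. If \<open>xy\<close>
  created neither a matching of a new size nor a new \<open>P_6 + jP_2\<close> inside
  \<open>U\<close>, the part in \<open>U\<close> of the copy made by \<open>xy\<close> could be
  exchanged for one without \<open>xy\<close>, giving a copy in \<open>E\<close> itself.\<close>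

lemma no_gain:
  assumes U: "adj_closed U" and xy: "x \<in> U" "y \<in> U" "x \<noteq> y" "{x, y} \<notin> E"
  shows "(\<exists>M. M \<subseteq> insert {x, y} (inner_edges U) \<and> matching M \<and>
            (\<forall>M'. M' \<subseteq> inner_edges U \<longrightarrow> matching M' \<longrightarrow> card M' \<noteq> card M)) \<or>
         (\<exists>j. P6_plus (insert {x, y} (inner_edges U)) j \<and> \<not> P6_plus (inner_edges U) j)"
proof (rule ccontr)
  assume "\<not> ?thesis"
  then have matchings: "\<And>M. M \<subseteq> insert {x, y} (inner_edges U) \<Longrightarrow> matching M \<Longrightarrow>
       \<exists>M'. M' \<subseteq> inner_edges U \<and> matching M' \<and> card M' = card M"
    and paths: "\<And>j. P6_plus (insert {x, y} (inner_edges U)) j \<Longrightarrow> P6_plus (inner_edges U) j" by blast+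
  have V: "x \<in> V" "y \<in> V" using U xy by (auto simp: adj_closed_def)
  obtain p M where p: "is_path (insert {x, y} E) p" "length p = 6"
    and M: "M \<subseteq> insert {x, y} E" "finite M" "matching M" "card M = t" "\<forall>e\<in>M. e \<inter> set p = {}"
    using P6_plusE[OF sat[OF V xy(3,4)]] .
  have adj_closed': "e \<subseteq> U" if "e \<in> insert {x, y} E" "e \<inter> U \<noteq> {}" for e
    using that U xy by (auto simp: adj_closed_def)
  \<comment> \<open>The matching of the copy splits into the edges inside \<open>U\<close>, possibly
    with \<open>xy\<close>, and those disjoint from \<open>U\<close>, which are all old.\<close>
  define MU where "MU = {e \<in> M. e \<subseteq> U}"
  define MW where "MW = M - MU"
  have MU: "MU \<subseteq> insert {x, y} (inner_edges U)" using M(1) by (auto simp: MU_def inner_edges_def)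
  have MW: "e \<inter> U = {} \<and> e \<in> E" if "e \<in> MW" for e
    using that M(1) adj_closed'[of e] xy by (auto simp: MW_def MU_def)
  have "MU \<subseteq> M" "MW \<subseteq> M" by (auto simp: MU_def MW_def)
  then have "matching MU" "matching MW" using M(3) by (auto intro: matching_subset)
  have "card MU \<le> card M" using M(2) \<open>MU \<subseteq> M\<close> by (rule card_mono)
  then have card: "card MU + card MW = t"
    using M(2,4) \<open>MU \<subseteq> M\<close> finite_subset[of MU M] unfolding MW_def by (simp add: card_Diff_subset)
  have join: "M' \<union> MW \<subseteq> E" "finite (M' \<union> MW)" "matching (M' \<union> MW)" "card (M' \<union> MW) = t"
    if M': "M' \<subseteq> inner_edges U" "matching M'" "card M' = card MU" for M'
  proof -
    show "M' \<union> MW \<subseteq> E" using M' MW by (auto simp: inner_edges_def)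
    have "finite M'" using M'(1) finE inner_edges_subset by (meson finite_subset)
    then show "finite (M' \<union> MW)" using M(2) by (auto simp: MW_def)
    have M'_MW: "e \<inter> f = {}" if "e \<in> M'" "f \<in> MW" for e f
      using that M'(1) MW[OF that(2)] by (auto simp: inner_edges_def)
    then show "matching (M' \<union> MW)" using M'(2) \<open>matching MW\<close>
      unfolding matching_def pairwise_def disjnt_def by (metis Un_iff inf_commute)
    have "e \<notin> M'" if "e \<in> MW" for e
    proof
      assume "e \<in> M'"
      then have "e = {}" using M'_MW[of e e] that by simp
      then show False using edge[of e] MW[OF that] by simp
    qed
    then have disj: "M' \<inter> MW = {}" by blast
    have "finite MW" using M(2) by (simp add: MW_def)
    show "card (M' \<union> MW) = t"
      using card_Un_disjoint[OF \<open>finite M'\<close> \<open>finite MW\<close> disj] card M'(3) by simp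
  qed
  have "P6_plus E t"
  \<comment> \<open>If the path avoids \<open>U\<close>, only \<open>MU\<close> is exchanged;
    otherwise the path lies inside \<open>U\<close> and is exchanged together with
    \<open>MU\<close>.\<close>
  proof (cases "set p \<inter> U = {}")
    case True
    have "x \<notin> set p" using True xy by blast
    then have pE: "is_path E p"
      using p(1) unfolding is_path_def by (auto elim!: successively_mono simp: doubleton_eq_iff)
    obtain M' where M': "M' \<subseteq> inner_edges U" "matching M'" "card M' = card MU"
      using matchings[OF MU \<open>matching MU\<close>] by blast
    have "e \<inter> set p = {}" if "e \<in> M' \<union> MW" for e
      using that
    proof
      assume "e \<in> M'"
      then have "e \<subseteq> U" using M'(1) by (auto simp: inner_edges_def)
      then show ?thesis using True by blast
    next
      assume "e \<in> MW"
      then show ?thesis using M(5) \<open>MW \<subseteq> M\<close> by blast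
    qed
    with pE p(2) join[OF M'] show ?thesis by (rule P6_plusI)
  next
    case False
    have pU: "set p \<subseteq> U" by (rule path_closed[OF p(1) adj_closed' False])
    have "is_path {e \<in> insert {x, y} E. e \<subseteq> U} p" using p pU by (intro path_restrict) auto
    then have "is_path (insert {x, y} (inner_edges U)) p" by (rule path_mono) (auto simp: inner_edges_def)
    then have "P6_plus (insert {x, y} (inner_edges U)) (card MU)" (is ?P6)
      using p(2) MU finite_subset[OF \<open>MU \<subseteq> M\<close> M(2)] \<open>matching MU\<close> refl
    proof (rule P6_plusI)
      show "e \<inter> set p = {}" if "e \<in> MU" for e using M(5) \<open>MU \<subseteq> M\<close> that by blast
    qed
    obtain p' M' where p': "is_path (inner_edges U) p'" "length p' = 6"
      and M': "M' \<subseteq> inner_edges U" "finite M'" "matching M'" "card M' = card MU"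
        "\<forall>e\<in>M'. e \<inter> set p' = {}"
      using P6_plusE[OF paths[OF \<open>?P6\<close>]] .
    have "set p' \<subseteq> U"
    proof (rule path_closed[OF p'(1)])
      show "set p' \<inter> U \<noteq> {}"
        using p' by (auto simp: length_6_conv inner_edges_def)
    qed (auto simp: inner_edges_def)
    have "e \<inter> set p' = {}" if "e \<in> M' \<union> MW" for e
      using that
    proof
      assume "e \<in> MW"
      then show ?thesis using MW[of e] \<open>set p' \<subseteq> U\<close> by blast
    qed (use M'(5) in simp)
    with path_mono[OF p'(1) inner_edges_subset] p'(2) join[OF M'(1,3,4)] show ?thesis by (rule P6_plusI)
  qed
  then show False using no_copy by simp
qed

text \<open>An added edge that meets a minimum vertex cover \<open>K\<close> does not increase the matching number, and
  a path on six vertices together with further matching edges needs a cover of more than three vertices.\<close>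

lemma cover_dominates:
  assumes U: "adj_closed U" and K: "covers K (inner_edges U)" "K \<subseteq> U" "card K \<le> 3"
    and M: "M \<subseteq> inner_edges U" "matching M" "card M = card K"
    and P6: "card K = 3 \<Longrightarrow> P6_plus (inner_edges U) 0"
    and xy: "x \<in> K" "y \<in> U" "x \<noteq> y"
  shows "{x, y} \<in> E"
proof (rule ccontr)
  assume "{x, y} \<notin> E"
  have finK: "finite K" using K(2) adj_closed_finite[OF U] by (rule finite_subset)
  have cov: "covers K (insert {x, y} (inner_edges U))" using K(1) xy(1) by (auto simp: covers_def)
  have "x \<in> U" using xy K by blast
  from no_gain[OF U this xy(2,3) \<open>{x, y} \<notin> E\<close>] show False
  proof (elim disjE exE conjE)
    fix N assume N: "N \<subseteq> insert {x, y} (inner_edges U)" "matching N"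
      and max: "\<forall>M'. M' \<subseteq> inner_edges U \<longrightarrow> matching M' \<longrightarrow> card M' \<noteq> card N"
    have "card N \<le> card M"
      using matching_cover(2)[OF N(2) _ finK] cov N(1) M(3) by (auto simp: covers_def)
    then obtain M' where M': "M' \<subseteq> M" "card M' = card N" by (rule obtain_subset_with_card_n)
    have "M' \<subseteq> inner_edges U" using M'(1) M(1) by (rule order_trans)
    then show False using max M'(2) matching_subset[OF M(2) M'(1)] by simp
  next
    fix j assume j: "P6_plus (insert {x, y} (inner_edges U)) j" "\<not> P6_plus (inner_edges U) j"
    have "j + 3 \<le> card K" by (rule P6_cover[OF j(1) cov finK])
    then have "j = 0" "card K = 3" using K(3) by auto
    then show False using P6 j(2) by simp
  qed
qed

section \<open>Edge counts of components and trees\<close>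

text \<open>\<open>S\<close> grows by one vertex at a time: unless \<open>S = C\<close>, minimality
  of \<open>C\<close> yields an edge leaving \<open>S\<close>, and this edge is no longer counted
  once its outer end has joined \<open>S\<close>.\<close>

lemma component_edges:
  assumes C: "component C" and S: "S \<subseteq> C" "S \<noteq> {}"
  shows "card (C - S) \<le> card {e \<in> inner_edges C. \<not> e \<subseteq> S}"
  using S
proof (induction "card (C - S)" arbitrary: S)
  case 0
  then show ?case by simp
next
  case (Suc k)
  have "S \<noteq> C" using Suc.hyps(2) by auto
  then have "\<not> adj_closed S" using component_minimal[OF C _ Suc.prems(2,1)] by blast
  have "adj_closed C" using C by (rule component_closed)
  then have "S \<subseteq> V" using Suc.prems by (auto simp: adj_closed_def)
  then obtain e where e: "e \<in> E" "e \<inter> S \<noteq> {}" "\<not> e \<subseteq> S"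
    using \<open>\<not> adj_closed S\<close> by (auto simp: adj_closed_def)
  then have eC: "e \<in> inner_edges C" using \<open>adj_closed C\<close> Suc.prems by (auto simp: adj_closed_def inner_edges_def)
  obtain y where y: "y \<in> e" "y \<notin> S" using e by blast
  then have yC: "y \<in> C" using eC by (auto simp: inner_edges_def)
  obtain x where x: "x \<in> e" "x \<in> S" using e by blast
  have e_eq: "e = {x, y}"
    using edge[OF e(1)] x y by (auto simp: card_2_iff)
  have fin: "finite {e \<in> inner_edges C. \<not> e \<subseteq> S}" using finE by (auto simp: inner_edges_def)
  have fC: "finite C" using \<open>adj_closed C\<close> by (rule adj_closed_finite)
  have *: "C - S = insert y (C - insert y S)" using y yC by auto
  have card: "card (C - S) = Suc (card (C - insert y S))"
    unfolding * using fC by simp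
  have "card (C - insert y S) \<le> card {e \<in> inner_edges C. \<not> e \<subseteq> insert y S}"
    using card Suc.hyps(2) Suc.prems yC by (intro Suc.hyps(1)) auto
  moreover have "insert e {e \<in> inner_edges C. \<not> e \<subseteq> insert y S} \<subseteq> {e \<in> inner_edges C. \<not> e \<subseteq> S}"
    using eC e by auto
  then have "card (insert e {e \<in> inner_edges C. \<not> e \<subseteq> insert y S}) \<le> card {e \<in> inner_edges C. \<not> e \<subseteq> S}"
    by (rule card_mono[OF fin])
  moreover have "card (insert e {e \<in> inner_edges C. \<not> e \<subseteq> insert y S}) = Suc (card {e \<in> inner_edges C. \<not> e \<subseteq> insert y S})"
    using e_eq x finE by (subst card_insert_disjoint) (auto simp: inner_edges_def)
  ultimately show ?case using card by simp
qed

lemma component_card: "component C \<Longrightarrow> card C \<le> Suc (card (inner_edges C))"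
proof -
  assume C: "component C"
  then obtain x where x: "x \<in> C" using component_nonempty by blast
  have "finite C" "finite (inner_edges C)"
    using adj_closed_finite[OF component_closed[OF C]] finE by (auto simp: inner_edges_def)
  then have "card (C - {x}) \<le> card (inner_edges C)"
    using component_edges[OF C, of "{x}"] x by (auto elim!: order_trans intro: card_mono)
  then show ?thesis using x \<open>finite C\<close> by simp
qed

text \<open>A nonempty edge set without vertices of degree one has at least as many edges as
  vertices, by the handshake lemma. Every other vertex of \<open>C\<close> costs one more edge, so
  \<open>C\<close> would have too many edges for a tree.\<close>

lemma tree_forest:
  assumes "tree C" shows "forest (inner_edges C)"
  unfolding forest_def
proof (intro allI impI, rule ccontr)
  fix F assume F: "F \<subseteq> inner_edges C" "F \<noteq> {}" "\<not> (\<exists>v. deg F v = 1)"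
  have C: "component C" and cC: "Suc (card (inner_edges C)) = card C" using assms by (auto simp: tree_def)
  have fin: "finite C" "finite (inner_edges C)" "finite F"
    using adj_closed_finite[OF component_closed[OF C]] finE F(1) finite_subset[of F "inner_edges C"]
    by (auto simp: inner_edges_def)
  have sub: "\<Union>F \<subseteq> C" using F(1) by (auto simp: inner_edges_def)
  then have finU: "finite (\<Union>F)" using fin(1) finite_subset by blast
  have "2 \<le> deg F v" if v: "v \<in> \<Union>F" for v
  proof -
    have "deg F v \<noteq> 0" using v fin(3) by (auto simp: deg_def)
    then show ?thesis using F(3) by (metis One_nat_def Suc_1 Suc_leI le_neq_implies_less less_one not_le)
  qed
  then have "(\<Sum>v\<in>\<Union>F. 2) \<le> (\<Sum>v\<in>\<Union>F. deg F v)" by (rule sum_mono)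
  also have "\<dots> = 2 * card F"
    using F(1) edge finU fin(3) by (intro handshake) (auto simp: inner_edges_def)
  finally have "card (\<Union>F) \<le> card F" by simp
  moreover have "\<Union>F \<noteq> {}" using F(1,2) edge by (fastforce simp: inner_edges_def)
  then have "card (C - \<Union>F) \<le> card {e \<in> inner_edges C. \<not> e \<subseteq> \<Union>F}" using component_edges[OF C sub] by simp
  moreover have "card (C - \<Union>F) = card C - card (\<Union>F)" using sub finU by (simp add: card_Diff_subset)
  moreover have "card (\<Union>F) \<le> card C" using sub fin(1) by (simp add: card_mono)
  moreover have "card F + card {e \<in> inner_edges C. \<not> e \<subseteq> \<Union>F} \<le> card (inner_edges C)"
  proof -
    have "card F + card {e \<in> inner_edges C. \<not> e \<subseteq> \<Union>F} = card (F \<union> {e \<in> inner_edges C. \<not> e \<subseteq> \<Union>F})"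
      using fin by (subst card_Un_disjoint) auto
    also have "\<dots> \<le> card (inner_edges C)" using F(1) fin(2) by (intro card_mono) auto
    finally show ?thesis .
  qed
  ultimately show False using cC by linarith
qed

lemma inner_edgesD: "e \<in> inner_edges U \<Longrightarrow> e \<in> E \<and> e \<subseteq> U \<and> card e = 2"
  using edge by (auto simp: inner_edges_def)

lemma inner_edgesI: "{x, y} \<in> E \<Longrightarrow> x \<in> U \<Longrightarrow> y \<in> U \<Longrightarrow> {x, y} \<in> inner_edges U"
  by (auto simp: inner_edges_def)

lemma finite_inner_edges: "finite (inner_edges U)"
  using finE inner_edges_subset by (rule finite_subset[rotated])

lemma tree_component: "tree C \<Longrightarrow> component C"
  by (simp add: tree_def)

lemma inner_edges_nonempty:
  assumes "component C" shows "inner_edges C \<noteq> {}"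
proof -
  obtain x where x: "x \<in> C" using component_nonempty[OF assms] by blast
  then have "x \<in> V" using component_closed[OF assms] by (auto simp: adj_closed_def)
  then obtain e where e: "e \<in> E" "x \<in> e" using no_isolated by blast
  then have "e \<subseteq> C" using adj_closedD[OF component_closed[OF assms] e(1)] x by blast
  then show ?thesis using e(1) by (auto simp: inner_edges_def)
qed

section \<open>Matchings in tree components\<close>

text \<open>By \<open>cover_dominates\<close> every vertex of \<open>K\<close> is adjacent to all
  other vertices of \<open>C\<close>, so two vertices of \<open>K\<close> and any third vertex form
  a triangle.\<close>

lemma tree_cover_contradiction:
  assumes "tree C" and K: "covers K (inner_edges C)" "K \<subseteq> C" "2 \<le> card K" "card K \<le> 3"
    and M: "M \<subseteq> inner_edges C" "matching M" "card M = card K"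
    and P6: "card K = 3 \<Longrightarrow> P6_plus (inner_edges C) 0"
  shows False
proof -
  have cl: "adj_closed C" using assms(1) by (intro component_closed tree_component)
  obtain x y where xy: "x \<in> K" "y \<in> K" "x \<noteq> y"
    using K(3) by (metis One_nat_def card_le_Suc0_iff_eq card.infinite not_less_eq_eq numeral_2_eq_2 zero_le)
  \<comment> \<open>With no third vertex \<open>M\<close> would consist of at most one edge, but it
    has at least two.\<close>
  have "\<exists>z\<in>C. z \<noteq> x \<and> z \<noteq> y"
  proof (rule ccontr)
    assume none: "\<not> ?thesis"
    have "e = {x, y}" if "e \<in> M" for e
    proof -
      have "e \<subseteq> {x, y}" "card e = 2" using inner_edgesD[of e C] that M(1) none by blast+
      then show ?thesis using xy(3) by (intro card_subset_eq) auto
    qed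
    then have "M \<subseteq> {{x, y}}" by blast
    then have "card M \<le> 1" using card_mono[of "{{x, y}}" M] by simp
    then show False using M(3) K(3) by simp
  qed
  then obtain z where z: "z \<in> C" "z \<noteq> x" "z \<noteq> y" by blast
  have "{x, y} \<in> E" "{x, z} \<in> E" "{y, z} \<in> E"
    using cover_dominates[OF cl K(1,2,4) M P6] xy z K(2) by auto
  then have "is_path (inner_edges C) [x, y, z]" "{hd [x, y, z], last [x, y, z]} \<in> inner_edges C"
    using xy z K(2) by (auto intro: inner_edgesI)
  then show False using forest_no_cycle[OF tree_forest[OF assms(1)]] by fastforce
qed

text \<open>A single edge counts as a star. The matching number of a star is at most one.\<close>

definition star :: "'a set \<Rightarrow> bool" where
  "star C \<longleftrightarrow> (\<exists>c\<in>C. covers {c} (inner_edges C))"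

text \<open>Koenig's theorem gives a cover and a matching of equal size. Size 0 would mean no edges,
  size 1 a star, and size 2 is ruled out by \<open>tree_cover_contradiction\<close>.\<close>

lemma tree_matching:
  assumes "tree C" "\<not> star C"
  obtains M where "M \<subseteq> inner_edges C" "matching M" "card M = 3"
proof -
  obtain K M where KM: "finite K" "K \<subseteq> \<Union>(inner_edges C)" "covers K (inner_edges C)"
    "M \<subseteq> inner_edges C" "matching M" "card M = card K"
    using forest_konig[OF finite_inner_edges _ tree_forest[OF assms(1)]] inner_edgesD by metis
  have KC: "K \<subseteq> C" using KM(2) inner_edgesD by blast
  have "card K \<noteq> 0"
  proof
    assume "card K = 0"
    then have "inner_edges C = {}" using KM(1,3) by (auto simp: covers_def)
    then show False using inner_edges_nonempty[OF tree_component[OF assms(1)]] by simp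
  qed
  moreover have "card K \<noteq> 1"
  proof
    assume "card K = 1"
    then obtain c where "K = {c}" by (rule card_1_singletonE)
    then show False using assms(2) KM(3) KC by (auto simp: star_def)
  qed
  moreover have "card K \<noteq> 2" using tree_cover_contradiction[OF assms(1) KM(3) KC _ _ KM(4-6)] by auto
  ultimately have "3 \<le> card M" using KM(6) by linarith
  then obtain N where N: "N \<subseteq> M" "card N = 3" by (rule obtain_subset_with_card_n)
  then show thesis using that[of N] KM(4) matching_subset[OF KM(5) N(1)] by simp
qed

text \<open>The two centres form a minimum cover of \<open>C \<union> D\<close>, so
  \<open>cover_dominates\<close> would make them adjacent across two components.\<close>

lemma star_unique:
  assumes "tree C" "tree D" "star C" "star D" shows "C = D"
proof (rule ccontr)
  assume "C \<noteq> D"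
  have comp: "component C" "component D" using assms by (simp_all add: tree_component)
  have disj: "C \<inter> D = {}" using component_disjoint[OF comp \<open>C \<noteq> D\<close>] .
  note cl = component_closed[OF comp(1)] component_closed[OF comp(2)]
  obtain c d where c: "c \<in> C" "covers {c} (inner_edges C)" and d: "d \<in> D" "covers {d} (inner_edges D)"
    using assms(3,4) by (auto simp: star_def)
  have split: "e \<in> inner_edges C \<or> e \<in> inner_edges D" if e: "e \<in> inner_edges (C \<union> D)" for e
  proof -
    have "e \<in> E" "e \<subseteq> C \<union> D" "e \<noteq> {}" using inner_edgesD[OF e] by auto
    moreover from this(1) have "e \<inter> C = {} \<or> e \<subseteq> C" "e \<inter> D = {} \<or> e \<subseteq> D" using adj_closedD cl by blast+
    ultimately show ?thesis unfolding inner_edges_def by blast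
  qed
  obtain e f where ef: "e \<in> inner_edges C" "f \<in> inner_edges D"
    using inner_edges_nonempty[OF comp(1)] inner_edges_nonempty[OF comp(2)] by blast
  then have ef': "e \<subseteq> C" "f \<subseteq> D" "e \<noteq> {}" using inner_edgesD[OF ef(1)] inner_edgesD[OF ef(2)] by auto
  then have "e \<inter> f = {}" "e \<noteq> f" using disj by blast+
  have "c \<noteq> d" using c d disj by blast
  have "{c, d} \<in> E"
  proof (rule cover_dominates)
    show "adj_closed (C \<union> D)" using cl by (rule adj_closed_Un)
    show "covers {c, d} (inner_edges (C \<union> D))" using split c(2) d(2) unfolding covers_def by blast
    show "{e, f} \<subseteq> inner_edges (C \<union> D)" using ef by (auto simp: inner_edges_def)
    show "matching {e, f}" using \<open>e \<inter> f = {}\<close> by (auto simp: matching_def pairwise_def disjnt_def)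
    show "card {e, f} = card {c, d}" using \<open>e \<noteq> f\<close> \<open>c \<noteq> d\<close> by simp
  qed (use c d \<open>c \<noteq> d\<close> in auto)
  then show False using edge_closed[OF cl(1)] c(1) d(1) disj by blast
qed

text \<open>Otherwise every edge meets every \<open>P_6\<close>. Around a fixed path
  \<open>abcdef\<close>, rerouting and the exclusion of covers of size three force neighbours off
  the path at \<open>c\<close> and \<open>d\<close>, and none at \<open>a\<close> and
  \<open>f\<close>. Then adding \<open>bd\<close> gains nothing, against
  \<open>no_gain\<close>.\<close>

lemma tree_P6_plus_1:
  assumes "tree D" "P6_plus (inner_edges D) 0"
  shows "P6_plus (inner_edges D) 1"
proof (rule ccontr)
  assume not1: "\<not> P6_plus (inner_edges D) 1"
  define F where "F = inner_edges D"
  note frst = tree_forest[OF assms(1), folded F_def]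
  have cl: "adj_closed D" using assms(1) by (intro component_closed tree_component)
  have edgeF: "card g = 2" "g \<subseteq> D" "g \<in> E" if "g \<in> F" for g using inner_edgesD[of g D] that by (auto simp: F_def)
  have touch: "g \<inter> set p \<noteq> {}" if "is_path F p" "length p = 6" "g \<in> F" for p g
  proof
    assume "g \<inter> set p = {}"
    with that have "P6_plus F 1" by (intro P6_plusI[of F p "{g}"]) (auto simp: matching_def)
    then show False using not1 by (simp add: F_def)
  qed
  have cycle: False if "is_path F p" "length p \<ge> 3" "{hd p, last p} \<in> F" for p
    using forest_no_cycle[OF frst that] .
  \<comment> \<open>A cover of three vertices has the same size as the matching \<open>ab\<close>,
    \<open>cd\<close>, \<open>ef\<close>, which \<open>tree_cover_contradiction\<close>
    excludes.\<close>
  have small_cover: False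
    if "is_path F [a, b, c, d, e, f]" "covers {x, y, z} F" "x \<noteq> y" "y \<noteq> z" "x \<noteq> z"
      "{x, y, z} \<subseteq> {a, b, c, d, e, f}" for a b c d e f x y z
  proof -
    have N: "{{a, b}, {c, d}, {e, f}} \<subseteq> F" "matching {{a, b}, {c, d}, {e, f}}" "card {{a, b}, {c, d}, {e, f}} = 3"
      using that(1) by (auto simp: matching_def pairwise_def disjnt_def doubleton_eq_iff)
    have "{a, b, c, d, e, f} \<subseteq> D"
      using that(1) edgeF(2)[of "{a, b}"] edgeF(2)[of "{c, d}"] edgeF(2)[of "{e, f}"] by simp
    then have "{x, y, z} \<subseteq> D" using that(6) by (rule order_trans[rotated])
    then show False
      using tree_cover_contradiction[OF assms(1) that(2)[unfolded F_def] _ _ _ N(1)[unfolded F_def] N(2)] assms(2) N(3) that(3-5)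
      by simp
  qed
  obtain p where p: "is_path F p" "length p = 6" using assms(2) unfolding F_def by (rule P6_plusE)
  define outer where "outer p v \<longleftrightarrow> (\<exists>z. z \<notin> set p \<and> {v, z} \<in> F)" for p v
  \<comment> \<open>An edge with both ends on the path is a path edge, since \<open>F\<close> has no
    cycle; any other edge hangs on the path at an \<open>outer\<close> vertex.\<close>
  have edges: "g \<in> {{a, b}, {b, c}, {c, d}, {d, e}, {e, f}} \<or>
      (\<exists>v. v \<in> {a, b, c, d, e, f} \<and> outer [a, b, c, d, e, f] v \<and> v \<in> g)"
    if P: "is_path F [a, b, c, d, e, f]" and g: "g \<in> F" for a b c d e f g
  proof -
    let ?P = "{a, b, c, d, e, f}"
    obtain u where u: "u \<in> g" "u \<in> ?P" using touch[OF P _ g] by auto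
    obtain v where v: "g = {u, v}" "u \<noteq> v" using edgeF(1)[OF g] u(1) by (auto simp: card_2_iff)
    show ?thesis
    proof (cases "v \<in> ?P")
      case False
      then have "outer [a, b, c, d, e, f] u" using g v by (auto simp: outer_def)
      then show ?thesis using u by blast
    next
      case True
      let ?p = "[a, b, c, d, e, f]"
      have "{u, v} \<in> F" "u \<in> set ?p" "v \<in> set ?p" using g v(1) u(2) True by simp_all
      then obtain i where i: "Suc i < length ?p" "{u, v} = {?p ! i, ?p ! Suc i}"
        using forest_path_edge[OF frst P _ _ _ v(2)] by metis
      from i(1) have "i = 0 \<or> i = 1 \<or> i = 2 \<or> i = 3 \<or> i = 4" by auto
      then have "{u, v} \<in> {{a, b}, {b, c}, {c, d}, {d, e}, {e, f}}"
        using i(2) by (elim disjE) simp_all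
      then show ?thesis unfolding v(1) by (rule disjI1)
    qed
  qed
  \<comment> \<open>Given a neighbour \<open>x\<close> of \<open>a\<close> off the path, a neighbour
    \<open>y\<close> of \<open>f\<close>, \<open>b\<close> or \<open>d\<close> off the path yields a
    \<open>P_6\<close> through \<open>x\<close> or \<open>y\<close> that misses an edge. So only
    \<open>a\<close>, \<open>c\<close>, \<open>e\<close> can be \<open>outer\<close>; they also meet
    all path edges and hence cover \<open>F\<close>.\<close>
  have outer_first: False
    if P: "is_path F [a, b, c, d, e, f]" and out: "outer [a, b, c, d, e, f] a" for a b c d e f
  proof -
    obtain x where x: "x \<notin> {a, b, c, d, e, f}" "{a, x} \<in> F" using out by (auto simp: outer_def)
    have "\<not> outer [a, b, c, d, e, f] f"
    proof
      assume "outer [a, b, c, d, e, f] f"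
      then obtain y where y: "y \<notin> {a, b, c, d, e, f}" "{f, y} \<in> F" by (auto simp: outer_def)
      have "y \<noteq> x" using cycle[of "[x,a,b,c,d,e,f]"] P x y by (auto simp: insert_commute)
      then show False using touch[of "[x,a,b,c,d,e]" "{f, y}"] P x y by (auto simp: insert_commute)
    qed
    moreover have "\<not> outer [a, b, c, d, e, f] b"
    proof
      assume "outer [a, b, c, d, e, f] b"
      then obtain y where y: "y \<notin> {a, b, c, d, e, f}" "{b, y} \<in> F" by (auto simp: outer_def)
      have "y \<noteq> x" using cycle[of "[x,a,b]"] P x y by (auto simp: insert_commute)
      then show False using touch[of "[y,b,c,d,e,f]" "{a, x}"] P x y by (auto simp: insert_commute)
    qed
    moreover have "\<not> outer [a, b, c, d, e, f] d"
    proof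
      assume "outer [a, b, c, d, e, f] d"
      then obtain y where y: "y \<notin> {a, b, c, d, e, f}" "{d, y} \<in> F" by (auto simp: outer_def)
      have "y \<noteq> x" using cycle[of "[x,a,b,c,d]"] P x y by (auto simp: insert_commute)
      then show False using touch[of "[x,a,b,c,d,y]" "{e, f}"] P x y by (auto simp: insert_commute)
    qed
    ultimately have "g \<inter> {a, c, e} \<noteq> {}" if "g \<in> F" for g
      using edges[OF P that] by auto
    then have "covers {a, c, e} F" by (auto simp: covers_def)
    then show False using small_cover[OF P, of a c e] P by simp
  qed
  obtain a b c d e f where p_eq: "p = [a, b, c, d, e, f]" using p(2) by (auto simp: length_6_conv)
  have P: "is_path F [a, b, c, d, e, f]" using p(1) by (simp add: p_eq)
  have P': "is_path F [f, e, d, c, b, a]" using P path_rev[of F "[a, b, c, d, e, f]"] by simp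
  have a: "\<not> outer [a, b, c, d, e, f] a" using outer_first[OF P] by blast
  have f: "\<not> outer [a, b, c, d, e, f] f" using outer_first[OF P'] by (auto simp: outer_def)
  \<comment> \<open>If \<open>c\<close> were not \<open>outer\<close>, \<open>{b, d, e}\<close>
    would be a cover of size three; for \<open>d\<close> below, \<open>{b, c, e}\<close> would
    be.\<close>
  have "outer [a, b, c, d, e, f] c"
  proof (rule ccontr)
    assume "\<not> ?thesis"
    then have "g \<inter> {b, d, e} \<noteq> {}" if "g \<in> F" for g using edges[OF P that] a f by auto
    then have "covers {b, d, e} F" by (auto simp: covers_def)
    then show False using small_cover[OF P, of b d e] P by simp
  qed
  then obtain z where z: "z \<notin> {a, b, c, d, e, f}" "{c, z} \<in> F" by (auto simp: outer_def)
  have "outer [a, b, c, d, e, f] d"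
  proof (rule ccontr)
    assume "\<not> ?thesis"
    then have "g \<inter> {b, c, e} \<noteq> {}" if "g \<in> F" for g using edges[OF P that] a f by auto
    then have "covers {b, c, e} F" by (auto simp: covers_def)
    then show False using small_cover[OF P, of b c e] P by simp
  qed
  then obtain w where w: "w \<notin> {a, b, c, d, e, f}" "{d, w} \<in> F" by (auto simp: outer_def)
  have "z \<noteq> w" using cycle[of "[z,c,d]"] P z w by (auto simp: insert_commute)
  \<comment> \<open>\<open>?K\<close> covers \<open>F\<close> together with \<open>bd\<close> and
    has the size of the matching \<open>ab\<close>, \<open>cz\<close>, \<open>dw\<close>,
    \<open>ef\<close>, so adding \<open>bd\<close> does not increase the matching number.\<close>
  let ?K = "{b, c, d, e}"
  let ?F = "insert {b, d} F"
  have "g \<inter> ?K \<noteq> {}" if "g \<in> F" for g using edges[OF P that] a f by auto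
  then have cov: "covers ?K ?F" by (auto simp: covers_def)
  have covD: "g \<inter> ?K \<noteq> {}" if "g \<in> ?F" for g using cov that unfolding covers_def by (rule bspec)
  have cardK: "card ?K = 4" using P by simp
  have D: "b \<in> D" "d \<in> D" "b \<noteq> d" using P edgeF(2)[of "{a, b}"] edgeF(2)[of "{c, d}"] by simp_all
  have "{b, d} \<notin> F" using cycle[of "[b,c,d]"] P by auto
  then have "{b, d} \<notin> E" using D by (auto simp: F_def inner_edges_def)
  from no_gain[OF cl D this, folded F_def] show False
  proof (elim disjE exE conjE)
    fix M assume M: "M \<subseteq> ?F" "matching M" and max: "\<forall>M'. M' \<subseteq> F \<longrightarrow> matching M' \<longrightarrow> card M' \<noteq> card M"
    let ?N = "{{a, b}, {c, z}, {d, w}, {e, f}}"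
    have "card M \<le> card ?K" using cov M by (intro matching_cover(2)) (auto simp: covers_def)
    moreover have "card ?N = 4" using P z w \<open>z \<noteq> w\<close> by (auto simp: doubleton_eq_iff)
    ultimately have "card M \<le> card ?N" using cardK by simp
    then obtain N where N: "N \<subseteq> ?N" "card N = card M" by (rule obtain_subset_with_card_n)
    have "matching ?N" using P z w \<open>z \<noteq> w\<close> by (auto simp: matching_def pairwise_def disjnt_def)
    then have "matching N" using N(1) by (rule matching_subset)
    moreover have "?N \<subseteq> F" using P z w by simp
    then have "N \<subseteq> F" using N(1) by (rule order_trans[rotated])
    ultimately show False using max N(2) by blast
  next
    fix j assume j: "P6_plus ?F j" "\<not> P6_plus F j"
    obtain q M where q: "is_path ?F q" "length q = 6" and M: "M \<subseteq> ?F" "card M = j"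
      and qM: "\<forall>g\<in>M. g \<inter> set q = {}" using j(1) by (rule P6_plusE)
    \<comment> \<open>A vertex outside \<open>?K\<close> has all its neighbours in
      \<open>?K\<close>, and two of them would close a cycle with a segment of
      \<open>b, c, d, e\<close>.\<close>
    have leaf: "u = u'" if "v \<notin> ?K" "{v, u} \<in> ?F" "{v, u'} \<in> ?F" for v u u'
    proof (rule ccontr)
      assume "u \<noteq> u'"
      have F: "{v, u} \<in> F" "{v, u'} \<in> F" using that by (auto simp: doubleton_eq_iff)
      have "u \<in> ?K" using covD[OF that(2)] that(1) by auto
      moreover have "u' \<in> ?K" using covD[OF that(3)] that(1) by auto
      moreover have *: False
        if "{v, x} \<in> F" "{v, y} \<in> F" "(x, y) \<in> {(b, c), (b, d), (b, e), (c, d), (c, e), (d, e)}" for x y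
        using that(3)
      proof (elim insertE emptyE Pair_inject, goal_cases)
        case 1 then show ?case using cycle[of "[b,c,v]"] P \<open>v \<notin> ?K\<close> that by (auto simp: insert_commute)
      next
        case 2 then show ?case using cycle[of "[b,c,d,v]"] P \<open>v \<notin> ?K\<close> that by (auto simp: insert_commute)
      next
        case 3 then show ?case using cycle[of "[b,c,d,e,v]"] P \<open>v \<notin> ?K\<close> that by (auto simp: insert_commute)
      next
        case 4 then show ?case using cycle[of "[c,d,v]"] P \<open>v \<notin> ?K\<close> that by (auto simp: insert_commute)
      next
        case 5 then show ?case using cycle[of "[c,d,e,v]"] P \<open>v \<notin> ?K\<close> that by (auto simp: insert_commute)
      next
        case 6 then show ?case using cycle[of "[d,e,v]"] P \<open>v \<notin> ?K\<close> that by (auto simp: insert_commute)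
      qed
      ultimately show False using *[OF F] *[OF F(2,1)] \<open>u \<noteq> u'\<close> by auto
    qed
    obtain q1 q2 q3 q4 q5 q6 where q_eq: "q = [q1, q2, q3, q4, q5, q6]" using q(2) by (auto simp: length_6_conv)
    \<comment> \<open>The four inner vertices of \<open>q\<close> have two neighbours each, so they
      exhaust the cover \<open>?K\<close>. No edge is left for \<open>M\<close>, hence
      \<open>j = 0\<close>, but a \<open>P_6\<close> existed before.\<close>
    have "q2 \<in> ?K" using leaf[of q2 q1 q3] q(1) unfolding q_eq by (auto simp: insert_commute)
    moreover have "q3 \<in> ?K" using leaf[of q3 q2 q4] q(1) unfolding q_eq by (auto simp: insert_commute)
    moreover have "q4 \<in> ?K" using leaf[of q4 q3 q5] q(1) unfolding q_eq by (auto simp: insert_commute)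
    moreover have "q5 \<in> ?K" using leaf[of q5 q4 q6] q(1) unfolding q_eq by (auto simp: insert_commute)
    ultimately have "{q2, q3, q4, q5} \<subseteq> ?K" by simp
    moreover have "card {q2, q3, q4, q5} = card ?K" using cardK q(1) by (simp add: q_eq)
    ultimately have "{q2, q3, q4, q5} = ?K" by (intro card_subset_eq) auto
    then have "?K \<subseteq> set q" by (auto simp: q_eq)
    have "M = {}"
    proof (rule ccontr)
      assume "M \<noteq> {}"
      then obtain g where g: "g \<in> M" by blast
      then have "g \<inter> ?K \<noteq> {}" "g \<inter> set q = {}" using covD M(1) qM by blast+
      then show False using \<open>?K \<subseteq> set q\<close> by blast
    qed
    then show False using j(2) M(2) assms(2) by (simp add: F_def)
  qed
qed

section \<open>Counting tree components when there is a path on six vertices\<close>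

lemma path_in_component:
  assumes "is_path E p" "length p = 6"
  obtains D where "component D" "is_path (inner_edges D) p"
proof -
  obtain x y q where p: "p = x # y # q" using assms(2) by (auto simp: length_6_conv)
  then have "{x, y} \<in> E" using assms(1) by simp
  then obtain D where D: "component D" "{x, y} \<in> inner_edges D" by (rule edge_inner_edges)
  have "set p \<subseteq> D"
  proof (rule path_closed[OF assms(1)])
    show "e \<subseteq> D" if "e \<in> E" "e \<inter> D \<noteq> {}" for e using adj_closedD[OF component_closed[OF D(1)] that(1)] that(2) by blast
    show "set p \<inter> D \<noteq> {}" using p inner_edgesD[OF D(2)] by auto
  qed
  then have "is_path (inner_edges D) p" unfolding inner_edges_def using assms by (intro path_restrict) auto
  then show thesis using that D(1) by blast
qed

lemma inner_edges_disjoint: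
  assumes "component C" "component D" "C \<noteq> D" "e \<in> inner_edges C" "f \<in> inner_edges D"
  shows "e \<inter> f = {}"
  using component_disjoint[OF assms(1-3)] inner_edgesD[OF assms(4)] inner_edgesD[OF assms(5)] by blast

text \<open>Components are disjoint, so matchings chosen in components other than \<open>D\<close>
  can all be added to the copy inside \<open>D\<close>.\<close>

lemma P6_plus_components:
  assumes D: "component D" "P6_plus (inner_edges D) j"
    and fin: "finite \<A>" and A: "\<And>C. C \<in> \<A> \<Longrightarrow> component C \<and> C \<noteq> D"
    and m: "\<And>C. C \<in> \<A> \<Longrightarrow> m C \<subseteq> inner_edges C \<and> matching (m C)"
  shows "P6_plus E (j + (\<Sum>C\<in>\<A>. card (m C)))"
proof -
  obtain p M where p: "is_path (inner_edges D) p" "length p = 6" and M: "M \<subseteq> inner_edges D" "finite M" "matching M"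
    "card M = j" and pM: "\<forall>e\<in>M. e \<inter> set p = {}" using D(2) by (rule P6_plusE)
  define N where "N = (\<Union>C\<in>\<A>. m C)"
  have finm: "finite (m C)" if "C \<in> \<A>" for C using m[OF that] finite_inner_edges finite_subset by blast
  have ne: "e \<inter> e \<noteq> {}" if "e \<in> inner_edges C" for e C using inner_edgesD[OF that] by auto
  have disj: "e \<inter> f = {}" if "C \<in> \<A>" "C' \<in> \<A>" "C \<noteq> C'" "e \<in> m C" "f \<in> m C'" for C C' e f
    using inner_edges_disjoint[of C C' e f] that m A by blast
  have disjD: "e \<inter> f = {}" if "e \<in> inner_edges D" "f \<in> N" for e f
    using inner_edges_disjoint[OF D(1), of _ e f] that m A unfolding N_def by blast
  have "card N = (\<Sum>C\<in>\<A>. card (m C))"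
    unfolding N_def
  proof (rule card_UN_disjoint[OF fin])
    show "\<forall>C\<in>\<A>. finite (m C)" using finm by blast
    show "\<forall>C\<in>\<A>. \<forall>C'\<in>\<A>. C \<noteq> C' \<longrightarrow> m C \<inter> m C' = {}"
    proof (intro ballI impI equals0I)
      fix C C' e assume C: "C \<in> \<A>" "C' \<in> \<A>" "C \<noteq> C'" "e \<in> m C \<inter> m C'"
      then have "e \<inter> e = {}" using disj[of C C' e e] by simp
      moreover have "e \<in> inner_edges C" using m[OF C(1)] C(4) by blast
      ultimately show False using ne by blast
    qed
  qed
  moreover have "finite N" unfolding N_def using fin finm by simp
  moreover have "M \<inter> N = {}"
  proof (rule equals0I)
    fix e assume "e \<in> M \<inter> N"
    then have "e \<in> inner_edges D" "e \<in> N" using M(1) by blast+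
    then show False using disjD[of e e] ne[of e D] by simp
  qed
  ultimately have "card (M \<union> N) = j + (\<Sum>C\<in>\<A>. card (m C))" "finite (M \<union> N)"
    using M(2,4) by (simp_all add: card_Un_disjoint)
  moreover have "matching (M \<union> N)"
  proof -
    have "e \<inter> f = {}" if ef: "e \<in> N" "f \<in> N" "e \<noteq> f" for e f
    proof -
      obtain C C' where C: "C \<in> \<A>" "C' \<in> \<A>" "e \<in> m C" "f \<in> m C'" using ef by (auto simp: N_def)
      show ?thesis
      proof (cases "C = C'")
        case True
        then have "e \<in> m C" "f \<in> m C" using C by simp_all
        then show ?thesis using m[OF C(1)] ef(3) by (simp add: matching_def pairwise_def disjnt_def)
      next
        case False
        then show ?thesis using disj C by blast
      qed
    qed
    moreover have "e \<inter> f = {}" if "e \<in> M" "f \<in> N" for e f using disjD that M(1) by blast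
    moreover have "e \<inter> f = {}" if "e \<in> M" "f \<in> M" "e \<noteq> f" for e f
      using M(3) that by (simp add: matching_def pairwise_def disjnt_def)
    ultimately show ?thesis unfolding matching_def pairwise_def disjnt_def by (metis Un_iff inf_commute)
  qed
  moreover have "M \<union> N \<subseteq> E"
  proof -
    have "N \<subseteq> E" using m inner_edges_subset unfolding N_def by blast
    then show ?thesis using M(1) inner_edges_subset by blast
  qed
  moreover have "e \<inter> set p = {}" if "e \<in> M \<union> N" for e
    using that
  proof
    assume e: "e \<in> N"
    have "set p \<subseteq> D"
    proof (rule path_closed[OF p(1)])
      show "set p \<inter> D \<noteq> {}" using p inner_edgesD by (fastforce simp: length_6_conv)
    qed (use inner_edgesD in blast)
    obtain C where "C \<in> \<A>" "e \<in> m C" using e by (auto simp: N_def)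
    then have "e \<subseteq> C" "C \<inter> D = {}" using m inner_edgesD component_disjoint A D(1) by blast+
    then show ?thesis using \<open>set p \<subseteq> D\<close> by blast
  qed (use pM in simp)
  ultimately show ?thesis
    using path_mono[OF p(1) inner_edges_subset] p(2) by (intro P6_plusI[of E p "M \<union> N"]) auto
qed

lemma finite_components: "finite {C. component C}"
proof (rule finite_subset)
  show "{C. component C} \<subseteq> Pow V" using component_closed by (auto simp: adj_closed_def)
  show "finite (Pow V)" using finV by simp
qed

lemma finite_trees: "finite {C. tree C}"
  by (rule finite_subset[OF _ finite_components]) (auto simp: tree_component)

text \<open>Let \<open>D\<close> contain a \<open>P_6\<close>. Every other tree supplies three
  matching edges, except that at most one star supplies a single one; if \<open>D\<close> is a tree,
  it adds an edge by \<open>tree_P6_plus_1\<close>. Too many trees would thus complete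
  \<open>P_6 + tP_2\<close>.\<close>

lemma few_trees:
  assumes "P6_plus E 0" shows "3 * card {C. tree C} \<le> t + 3"
proof (rule ccontr)
  assume many: "\<not> ?thesis"
  obtain p where "is_path E p" "length p = 6" using assms by (rule P6_plusE)
  then obtain D where D: "component D" "is_path (inner_edges D) p" by (rule path_in_component)
  then have "P6_plus (inner_edges D) 0" using \<open>length p = 6\<close> by (intro path_6I) auto
  define \<A> where "\<A> = {C. tree C} - {D}"
  have "finite \<A>" using finite_trees by (simp add: \<A>_def)
  have "\<exists>M. M \<subseteq> inner_edges C \<and> matching M \<and> card M = (if star C then 1 else 3)" if C: "tree C" for C
  proof (cases "star C")
    case True
    obtain e where "e \<in> inner_edges C" using inner_edges_nonempty[OF tree_component[OF C]] by blast
    then show ?thesis using True by (intro exI[of _ "{e}"]) (simp add: matching_def)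
  next
    case False
    then show ?thesis using tree_matching[OF C False] by metis
  qed
  then obtain m where m: "\<And>C. tree C \<Longrightarrow> m C \<subseteq> inner_edges C \<and> matching (m C) \<and> card (m C) = (if star C then 1 else 3)"
    by metis
  define \<S> where "\<S> = {C \<in> \<A>. star C}"
  have "finite \<S>" using \<open>finite \<A>\<close> by (simp add: \<S>_def)
  moreover have "C = C'" if "C \<in> \<S>" "C' \<in> \<S>" for C C'
    using star_unique that by (simp add: \<S>_def \<A>_def)
  ultimately have "card \<S> \<le> 1" unfolding One_nat_def by (subst card_le_Suc0_iff_eq) auto
  have split: "\<A> \<inter> {C. star C} = \<S>" "\<A> \<inter> - {C. star C} = \<A> - \<S>" by (auto simp: \<S>_def)
  have "(\<Sum>C\<in>\<A>. card (m C)) = (\<Sum>C\<in>\<A>. if star C then 1 else 3)"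
    using m by (intro sum.cong) (auto simp: \<A>_def)
  also have "\<dots> = card \<S> + 3 * card (\<A> - \<S>)"
    using \<open>finite \<A>\<close> by (simp add: sum.If_cases split)
  also have "card (\<A> - \<S>) = card \<A> - card \<S>"
    using \<open>finite \<A>\<close> by (intro card_Diff_subset) (auto simp: \<S>_def)
  \<comment> \<open>The summand 2 is the deficit of the one possible star.\<close>
  finally have sum: "3 * card \<A> \<le> (\<Sum>C\<in>\<A>. card (m C)) + 2" using \<open>card \<S> \<le> 1\<close> by linarith
  have gain: "P6_plus E (j + (\<Sum>C\<in>\<A>. card (m C)))" if "P6_plus (inner_edges D) j" for j
    using m that by (intro P6_plus_components[OF D(1)]) (auto simp: finite_trees \<A>_def tree_component)
  show False
  proof (cases "tree D")
    case True
    \<comment> \<open>There are at least \<open>(t + 4) / 3\<close> trees. Leaving out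
      \<open>D\<close> still gives a sum of at least \<open>t - 1\<close>, and the extra edge inside
      \<open>D\<close> makes up for the missing one.\<close>
    then have "card \<A> = card {C. tree C} - 1" using finite_trees by (simp add: \<A>_def)
    then have "t \<le> 1 + (\<Sum>C\<in>\<A>. card (m C))" using sum many by linarith
    then show False
      using P6_plus_less[OF gain[OF tree_P6_plus_1[OF True \<open>P6_plus (inner_edges D) 0\<close>]]] no_copy by blast
  next
    case False
    then have "\<A> = {C. tree C}" by (auto simp: \<A>_def)
    then have "t \<le> 0 + (\<Sum>C\<in>\<A>. card (m C))" using sum many by simp
    then show False using P6_plus_less[OF gain[OF \<open>P6_plus (inner_edges D) 0\<close>]] no_copy by blast
  qed
qed

lemma sum_components:
  "card V = (\<Sum>C | component C. card C)"
  "card E = (\<Sum>C | component C. card (inner_edges C))"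
proof -
  have "V = \<Union>{C. component C}"
  proof
    show "V \<subseteq> \<Union>{C. component C}"
    proof
      fix x assume "x \<in> V"
      then obtain C where "component C" "x \<in> C" by (rule ex_component)
      then show "x \<in> \<Union>{C. component C}" by blast
    qed
    show "\<Union>{C. component C} \<subseteq> V"
    proof (rule Union_least)
      show "C \<subseteq> V" if "C \<in> {C. component C}" for C
        using component_closed[of C] that by (simp add: adj_closed_def)
    qed
  qed
  also have "card \<dots> = (\<Sum>C | component C. card C)"
    using component_disjoint finite_components adj_closed_finite component_closed
    by (subst card_Union_disjoint) (auto simp: pairwise_def disjnt_def)
  finally show "card V = (\<Sum>C | component C. card C)" .
  have "E = (\<Union>C\<in>{C. component C}. inner_edges C)"
  proof
    show "E \<subseteq> (\<Union>C\<in>{C. component C}. inner_edges C)"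
    proof
      fix e assume "e \<in> E"
      then obtain C where "component C" "e \<in> inner_edges C" by (rule edge_inner_edges)
      then show "e \<in> (\<Union>C\<in>{C. component C}. inner_edges C)" by blast
    qed
    show "(\<Union>C\<in>{C. component C}. inner_edges C) \<subseteq> E" by (intro UN_least inner_edges_subset)
  qed
  also have "card \<dots> = (\<Sum>C | component C. card (inner_edges C))"
  proof (rule card_UN_disjoint[OF finite_components])
    show "\<forall>C\<in>{C. component C}. \<forall>C'\<in>{C. component C}. C \<noteq> C' \<longrightarrow> inner_edges C \<inter> inner_edges C' = {}"
    proof (intro ballI impI equals0I)
      fix C C' e assume "C \<in> {C. component C}" "C' \<in> {C. component C}" "C \<noteq> C'" "e \<in> inner_edges C \<inter> inner_edges C'"
      then have "e \<inter> e = {}" "card e = 2"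
        using inner_edges_disjoint[of C C' e e] inner_edgesD[of e C] by simp_all
      then show False by auto
    qed
  qed (use finite_inner_edges in blast)
  finally show "card E = (\<Sum>C | component C. card (inner_edges C))" .
qed

text \<open>By \<open>component_card\<close>, a component that is not a tree has at least as many
  edges as vertices.\<close>

lemma card_V_le: "card V \<le> card E + card {C. tree C}"
proof -
  have "card V \<le> (\<Sum>C | component C. card (inner_edges C) + (if tree C then 1 else 0))"
    unfolding sum_components(1)
  proof (rule sum_mono)
    fix C assume "C \<in> {C. component C}"
    then show "card C \<le> card (inner_edges C) + (if tree C then 1 else 0)"
      using component_card[of C] by (auto simp: tree_def)
  qed
  also have "\<dots> = card E + card ({C. component C} \<inter> {C. tree C})"
    unfolding sum.distrib sum_components(2) using finite_components by (simp add: sum.If_cases)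
  also have "{C. component C} \<inter> {C. tree C} = {C. tree C}" using tree_component by blast
  finally show ?thesis .
qed

lemma card_trees_le:
  assumes "\<And>C. tree C \<Longrightarrow> k \<le> card C" shows "k * card {C. tree C} \<le> card V"
proof -
  have "k * card {C. tree C} = (\<Sum>C | tree C. k)" by simp
  also have "\<dots> \<le> (\<Sum>C | tree C. card C)" using assms by (intro sum_mono) simp
  also have "\<dots> \<le> (\<Sum>C | component C. card C)"
    using tree_component by (intro sum_mono2 finite_components) auto
  finally show ?thesis by (simp add: sum_components(1))
qed

section \<open>Tree components when there is no path on six vertices\<close>

lemma finite_nbrs: "finite (nbrs E v)"
  by (rule finite_subset[OF _ finV]) (use edge in \<open>auto simp: nbrs_def\<close>)

lemma tree_subset: "tree C \<Longrightarrow> C \<subseteq> V"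
  using component_closed[OF tree_component] by (simp add: adj_closed_def)

lemma tree_edge:
  assumes "tree C" "{x, y} \<in> E" "x \<in> C" shows "y \<in> C" "{x, y} \<in> inner_edges C"
  using edge_closed[OF component_closed[OF tree_component[OF assms(1)]] assms(2,3)] assms(2,3)
  by (auto intro: inner_edgesI)

lemma tree_path:
  assumes "tree C" "is_path E p" "2 \<le> length p" "set p \<inter> C \<noteq> {}"
  shows "is_path (inner_edges C) p" "set p \<subseteq> C"
proof -
  show "set p \<subseteq> C"
  proof (rule path_closed[OF assms(2) _ assms(4)])
    show "e \<subseteq> C" if "e \<in> E" "e \<inter> C \<noteq> {}" for e
      using adj_closedD[OF component_closed[OF tree_component[OF assms(1)]] that(1)] that(2) by blast
  qed
  then show "is_path (inner_edges C) p" unfolding inner_edges_def using assms(2,3) by (intro path_restrict)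
qed

lemma tree_no_cycle:
  assumes "tree C" "is_path E p" "3 \<le> length p" "{hd p, last p} \<in> E" "set p \<inter> C \<noteq> {}"
  shows False
proof -
  have p: "is_path (inner_edges C) p" "set p \<subseteq> C" using tree_path[OF assms(1,2) _ assms(5)] assms(3) by auto
  have "p \<noteq> []" using assms(3) by auto
  then have "hd p \<in> C" using p(2) by (auto dest: hd_in_set)
  then show False
    using forest_no_cycle[OF tree_forest[OF assms(1)] p(1) assms(3)] tree_edge(2)[OF assms(1,4)] by simp
qed

context
  assumes no_P6: "\<not> P6_plus E 0"
begin

lemma no_path_6: "is_path E p \<Longrightarrow> length p < 6"
  using path_6I no_P6 not_less by blast

text \<open>No \<open>P_6\<close> exists before, so the one produced by saturation must run through
  the new edge.\<close>

lemma new_path: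
  assumes "x \<in> V" "y \<in> V" "x \<noteq> y" "{x, y} \<notin> E"
  obtains xs ys where "is_path (insert {x, y} E) (xs @ x # y # ys)" "is_path E (xs @ [x])" "is_path E (y # ys)"
    "length xs + length ys = 4"
proof -
  obtain p where p: "is_path (insert {x, y} E) p" "length p = 6"
    using sat[OF assms] by (rule P6_plusE)
  have "\<not> is_path E p" using no_path_6[of p] p(2) by auto
  with p(1) obtain xs ys where "is_path (insert {x, y} E) (xs @ x # y # ys)" "is_path E (xs @ [x])"
    "is_path E (y # ys)" "length p = length xs + length ys + 2" by (rule new_edge_path)
  then show thesis using that p(2) by simp
qed

text \<open>If \<open>v\<close> had exactly the two neighbours \<open>x\<close>, \<open>y\<close>, then a path through the new edge \<open>xy\<close> could be
  rerouted through \<open>v\<close>.\<close>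

lemma nbrs_ne_2:
  assumes "tree C" "v \<in> C" shows "card (nbrs E v) \<noteq> 2"
proof
  assume "card (nbrs E v) = 2"
  then obtain x y where xy: "nbrs E v = {x, y}" "x \<noteq> y" by (auto simp: card_2_iff)
  have N: "w = x \<or> w = y" if "{v, w} \<in> E" for w using that xy(1) by (auto simp: nbrs_def)
  have E: "{v, x} \<in> E" "{v, y} \<in> E" using xy(1) by (auto simp: nbrs_def)
  have E': "{x, v} \<in> E" "{y, v} \<in> E" using E by (simp_all add: insert_commute)
  have V: "x \<in> V" "y \<in> V" using edge[OF E(1)] edge[OF E(2)] by auto
  have neq: "v \<noteq> x" "v \<noteq> y" using edge_neq E by auto
  have "{x, y} \<notin> E" using tree_no_cycle[OF assms(1), of "[x, v, y]"] E E' neq xy(2) assms(2) by auto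
  then obtain xs ys where p: "is_path (insert {x, y} E) (xs @ x # y # ys)"
    and ps: "is_path E (xs @ [x])" "is_path E (y # ys)" and len: "length xs + length ys = 4"
    using new_path[OF V xy(2)] by metis
  have dist: "distinct (xs @ x # y # ys)" using p by (simp add: is_path_def)
  consider "v \<notin> set xs" "v \<notin> set ys" | "v \<in> set xs" | "v \<in> set ys" by blast
  then show False
  proof cases
    case 1
    \<comment> \<open>A vertex \<open>v\<close> off the path can be inserted between
      \<open>x\<close> and \<open>y\<close>, giving a path on seven vertices in
      \<open>E\<close>.\<close>
    have "is_path E ((xs @ [x]) @ [v] @ (y # ys))"
      using ps E E' 1 neq dist unfolding path_append by auto
    then show False using no_path_6 len by fastforce
  next
    case 2
    \<comment> \<open>The path neighbours of \<open>v\<close> are among \<open>x\<close> and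
      \<open>y\<close>, so \<open>xs\<close> consists of \<open>v\<close> alone. Moving
      \<open>v\<close> between \<open>x\<close> and \<open>y\<close> keeps six vertices and avoids
      the new edge. The case of \<open>ys\<close> is symmetric.\<close>
    then obtain us vs where xs: "xs = us @ v # vs" by (auto simp: in_set_conv_decomp)
    have "vs = []"
    proof (cases vs)
      case (Cons w ws)
      then have "{v, w} \<in> E" using ps(1) xs by (simp add: path_append)
      then show ?thesis using N dist xs Cons by auto
    qed
    have "us = []"
    proof (cases us rule: rev_cases)
      case (snoc ws w)
      then have "{w, v} \<in> E" using ps(1) xs by (simp add: path_append)
      then show ?thesis using N[of w] dist xs snoc by (auto simp: insert_commute)
    qed
    have "is_path E ([x, v] @ (y # ys))"
      using ps(2) E' E dist neq xs unfolding path_append by auto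
    then show False using no_path_6 len xs \<open>vs = []\<close> \<open>us = []\<close> by fastforce
  next
    case 3
    then obtain us vs where ys: "ys = us @ v # vs" by (auto simp: in_set_conv_decomp)
    have ps2: "is_path E ((y # us) @ v # vs)" using ps(2) ys by simp
    have "us = []"
    proof (cases us rule: rev_cases)
      case (snoc ws w)
      then have "{w, v} \<in> E" using ps2 unfolding path_append by simp
      then show ?thesis using N[of w] dist ys snoc by (auto simp: insert_commute)
    qed
    have "vs = []"
    proof (cases vs)
      case (Cons w ws)
      then have "{v, w} \<in> E" using ps2 unfolding path_append by simp
      then show ?thesis using N dist ys Cons by auto
    qed
    have "is_path E ((xs @ [x]) @ [v, y])"
      using ps(1) E' E dist neq ys unfolding path_append by auto
    then show False using no_path_6 len ys \<open>vs = []\<close> \<open>us = []\<close> by fastforce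
  qed
qed

text \<open>The non-leaves; by \<open>nbrs_ne_2\<close> those of a tree component have at least
  three neighbours.\<close>

definition internal :: "'a set \<Rightarrow> 'a set" where
  "internal C = {v \<in> C. 2 \<le> card (nbrs E v)}"

lemma internalI:
  assumes "v \<in> C" "{v, x} \<in> E" "{v, y} \<in> E" "x \<noteq> y" shows "v \<in> internal C"
proof -
  have "card {x, y} \<le> card (nbrs E v)" using assms by (intro card_mono finite_nbrs) (auto simp: nbrs_def)
  then show ?thesis using assms by (simp add: internal_def)
qed

text \<open>Each of the four middle vertices of the new \<open>P_6\<close> has two neighbours on it,
  and apart from \<open>x\<close> and \<open>y\<close> these are joined to it by old edges.\<close>

lemma card_internal_Un:
  assumes C: "tree C" and xy: "x \<in> C" "y \<in> C" "x \<noteq> y" "{x, y} \<notin> E"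
  shows "4 \<le> card (internal C \<union> {x, y})"
proof -
  let ?E = "insert {x, y} E"
  have "x \<in> V" "y \<in> V" using tree_subset[OF C] xy by auto
  then obtain xs ys where p: "is_path ?E (xs @ x # y # ys)" "length xs + length ys = 4"
    using new_path xy(3,4) by metis
  have sub: "set (xs @ x # y # ys) \<subseteq> C"
  proof (rule path_closed[OF p(1)])
    show "e \<subseteq> C" if "e \<in> ?E" "e \<inter> C \<noteq> {}" for e
      using adj_closedD[OF component_closed[OF tree_component[OF C]], of e] that xy by auto
  qed (use xy in auto)
  have "length (xs @ x # y # ys) = 6" using p(2) by simp
  then obtain a b c d e f where p_eq: "xs @ x # y # ys = [a, b, c, d, e, f]" unfolding length_6_conv by blast
  have path: "is_path ?E [a, b, c, d, e, f]" using p(1) unfolding p_eq .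
  have int: "v \<in> internal C \<union> {x, y}" if "{v, u} \<in> ?E" "{v, w} \<in> ?E" "u \<noteq> w" "v \<in> C" for u v w
    using that internalI[of v C u w] by (auto simp: doubleton_eq_iff)
  have "{b, c, d, e} \<subseteq> internal C \<union> {x, y}"
    using int[of b a c] int[of c b d] int[of d c e] int[of e d f] path sub unfolding p_eq
    by (auto simp: insert_commute)
  moreover have "finite (internal C \<union> {x, y})"
    using finite_subset[OF tree_subset[OF C] finV] by (simp add: internal_def)
  ultimately have "card {b, c, d, e} \<le> card (internal C \<union> {x, y})" by (intro card_mono)
  then show ?thesis using path by simp
qed

lemma two_nbrs:
  assumes "v \<in> internal C" obtains x where "{v, x} \<in> E" "x \<noteq> w"
proof -
  have "\<not> nbrs E v \<subseteq> {w}"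
    using assms card_mono[of "{w}" "nbrs E v"] by (auto simp: internal_def)
  then show thesis using that by (auto simp: nbrs_def)
qed

text \<open>With one to three internal vertices, \<open>card_internal_Un\<close> fails for a
  suitable nonadjacent pair: two neighbours of the only one, a further neighbour of one of two and
  the other one, or two of three. Three pairwise adjacent ones would form a triangle.\<close>

lemma card_internal:
  assumes C: "tree C" shows "card (internal C) = 0 \<or> 4 \<le> card (internal C)"
proof (rule ccontr)
  assume "\<not> ?thesis"
  then consider "card (internal C) = 1" | "card (internal C) = 2" | "card (internal C) = 3" by linarith
  then show False
  proof cases
    case 1
    then obtain c where I: "internal C = {c}" by (rule card_1_singletonE)
    then have c: "c \<in> internal C" "c \<in> C" by (auto simp: internal_def)
    obtain x where x: "{c, x} \<in> E" "x \<noteq> c" using two_nbrs[OF c(1), of c] by blast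
    obtain y where y: "{c, y} \<in> E" "y \<noteq> x" using two_nbrs[OF c(1), of x] by blast
    have xyC: "x \<in> C" "y \<in> C" using tree_edge(1)[OF C] x y c by auto
    have "y \<noteq> c" using edge_neq[OF y(1)] by auto
    have "{x, y} \<notin> E"
      using tree_no_cycle[OF C, of "[x, c, y]"] x y c \<open>y \<noteq> c\<close> by (auto simp: insert_commute)
    then have "4 \<le> card {x, y, c}" using card_internal_Un[OF C xyC y(2)[symmetric]] I by (simp add: insert_commute)
    then show False by (simp add: card_insert_if split: if_splits)
  next
    case 2
    then obtain a b where I: "internal C = {a, b}" "a \<noteq> b" by (auto simp: card_2_iff)
    then have ab: "a \<in> internal C" "a \<in> C" "b \<in> C" by (auto simp: internal_def)
    obtain x where x: "{a, x} \<in> E" "x \<noteq> b" using two_nbrs[OF ab(1), of b] by blast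
    then have "x \<in> C" "x \<noteq> a" using tree_edge(1)[OF C] ab(2) edge_neq[OF x(1)] by auto
    then have "{x, b} \<notin> E" using internalI[of x C a b] x I by (auto simp: insert_commute)
    then have "4 \<le> card {a, b, x}" using card_internal_Un[OF C \<open>x \<in> C\<close> ab(3) x(2)] I by (simp add: insert_commute)
    then show False by (simp add: card_insert_if split: if_splits)
  next
    case 3
    then obtain a b c where I: "internal C = {a, b, c}" "a \<noteq> b" "b \<noteq> c" "a \<noteq> c" by (auto simp: card_3_iff)
    then have abc: "a \<in> C" "b \<in> C" "c \<in> C" by (auto simp: internal_def)
    have "{x, y} \<in> E" if "x \<in> {a, b, c}" "y \<in> {a, b, c}" "x \<noteq> y" for x y
    proof (rule ccontr)
      assume "{x, y} \<notin> E"
      moreover have "internal C \<union> {x, y} = internal C" using I(1) that by auto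
      ultimately show False using card_internal_Un[OF C, of x y] that abc 3 by auto
    qed
    then have "{a, b} \<in> E" "{b, c} \<in> E" "{a, c} \<in> E" using I by auto
    then show False using tree_no_cycle[OF C, of "[a, b, c]"] I abc by auto
  qed
qed

text \<open>Leaves have degree 1 and internal vertices degree at least 3, so the degree sum
  \<open>2 * card C - 2\<close> is at least \<open>card C + 2 * card (internal C)\<close>. Four
  internal vertices force ten vertices; none forces all degrees to be 1.\<close>

lemma tree_card:
  assumes C: "tree C" shows "card C = 2 \<or> 10 \<le> card C"
proof -
  have fin: "finite C" using tree_subset[OF C] finV by (rule finite_subset)
  have deg: "deg (inner_edges C) v = card (nbrs E v)" if "v \<in> C" for v
  proof -
    have "{e \<in> inner_edges C. v \<in> e} = {e \<in> E. v \<in> e}"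
      using adj_closedD[OF component_closed[OF tree_component[OF C]]] that by (auto simp: inner_edges_def)
    then show ?thesis using deg_eq_card_nbrs[of E v] edge by (simp add: deg_def)
  qed
  have "(\<Sum>v\<in>C. card (nbrs E v)) = 2 * card (inner_edges C)"
    using handshake[OF fin finite_inner_edges, of C] inner_edgesD deg by simp
  moreover have "Suc (card (inner_edges C)) = card C" using C by (simp add: tree_def)
  ultimately have sum: "(\<Sum>v\<in>C. card (nbrs E v)) + 2 = 2 * card C" by simp
  have pos: "card (nbrs E v) \<noteq> 0" if v: "v \<in> C" for v
  proof -
    obtain e where e: "e \<in> E" "v \<in> e" using no_isolated tree_subset[OF C] v by blast
    then have "deg E v \<noteq> 0" using finE by (auto simp: deg_def)
    then show ?thesis using deg_eq_card_nbrs[of E v] edge by simp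
  qed
  have split: "C \<inter> {v. v \<in> internal C} = internal C" "internal C \<subseteq> C" by (auto simp: internal_def)
  have "(\<Sum>v\<in>C. 1 + (if v \<in> internal C then 2 else 0)) = card C + 2 * card (internal C)"
    unfolding sum.distrib using fin split by (simp add: sum.If_cases)
  moreover have "(\<Sum>v\<in>C. 1 + (if v \<in> internal C then 2 else 0)) \<le> (\<Sum>v\<in>C. card (nbrs E v))"
  proof (rule sum_mono)
    fix v assume "v \<in> C"
    then show "1 + (if v \<in> internal C then 2 else 0) \<le> card (nbrs E v)"
      using nbrs_ne_2[OF C, of v] pos[of v] by (auto simp: internal_def)
  qed
  ultimately have ge: "card C + 2 * card (internal C) + 2 \<le> 2 * card C" using sum by simp
  show ?thesis
  proof (cases "card (internal C) = 0")
    case True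
    then have "internal C = {}" using finite_subset[OF split(2) fin] by simp
    then have "\<not> 2 \<le> card (nbrs E v)" if "v \<in> C" for v using that by (auto simp: internal_def)
    then have "card (nbrs E v) = 1" if "v \<in> C" for v using pos[OF that] that by fastforce
    then have "(\<Sum>v\<in>C. card (nbrs E v)) = card C" by simp
    then show ?thesis using sum by simp
  next
    case False
    then show ?thesis using card_internal[OF C] ge by auto
  qed
qed

text \<open>An edge added between the \<open>K_2\<close> and a vertex \<open>x\<close> of
  \<open>D\<close> creates a \<open>P_6\<close> with at most two vertices on the side of the
  \<open>K_2\<close>, so \<open>x\<close> is the end of a \<open>P_4\<close>. Such paths combine to
  a \<open>P_6\<close> inside \<open>D\<close>.\<close>

lemma K2_only_tree:
  assumes C: "tree C" "card C = 2" and D: "tree D" "D \<noteq> C" shows False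
proof -
  have comp: "component C" "component D" using C D by (simp_all add: tree_component)
  have disj: "C \<inter> D = {}" using component_disjoint[OF comp] D(2) by simp
  obtain u v where uv: "C = {u, v}" "u \<noteq> v" using C(2) by (auto simp: card_2_iff)
  have nbr: "w = v" if "{u, w} \<in> E" for w
    using tree_edge(1)[OF C(1) that] uv edge_neq[OF that] by auto
  have nbr': "w = u" if "{v, w} \<in> E" for w
    using tree_edge(1)[OF C(1) that] uv edge_neq[OF that] by auto
  have P4: "\<exists>a b c. is_path E [x, a, b, c]" if x: "x \<in> D" for x
  proof -
    have "u \<in> V" "x \<in> V" "u \<noteq> x" "{u, x} \<notin> E"
      using tree_subset[OF C(1)] tree_subset[OF D(1)] uv x disj tree_edge(1)[OF C(1), of u x] by auto
    then obtain xs ys where p: "is_path (insert {u, x} E) (xs @ u # x # ys)" "is_path E (xs @ [u])"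
      "is_path E (x # ys)" "length xs + length ys = 4" by (rule new_path)
    have "length xs \<le> 1"
    proof (cases xs rule: rev_cases)
      case (snoc zs z)
      then have "{z, u} \<in> E" using p(2) by (simp add: path_append)
      then have "z = v" using nbr by (simp add: insert_commute)
      show ?thesis
      proof (cases zs rule: rev_cases)
        case (snoc ws w)
        then have "{w, v} \<in> E" using p(2) \<open>xs = zs @ [z]\<close> \<open>z = v\<close> by (simp add: path_append)
        then have "w = u" using nbr' by (simp add: insert_commute)
        then show ?thesis using p(2) \<open>xs = zs @ [z]\<close> snoc by (simp add: path_append)
      qed (use snoc in simp)
    qed simp
    then have "3 \<le> length ys" using p(4) by simp
    then obtain a b c zs where "ys = a # b # c # zs"
      by (metis One_nat_def Suc_le_length_iff numeral_3_eq_3)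
    then show ?thesis using p(3) by auto
  qed
  \<comment> \<open>If the \<open>P_4\<close> starting at \<open>b\<close> did not go back through
    \<open>a\<close>, it would extend \<open>x, a, b\<close> to a \<open>P_6\<close>.\<close>
  have step: "d = a" if x: "x \<in> D" and p: "is_path E [x, a, b, c]" and q: "is_path E [b, d, e, f]" for x a b c d e f
  proof (rule ccontr)
    assume "d \<noteq> a"
    note cyc = tree_no_cycle[OF D(1)]
    have ab: "a \<in> D" "b \<in> D" using tree_edge(1)[OF D(1)] p x by auto
    have "d \<noteq> x" using cyc[of "[x, a, b]"] p q x by (auto simp: insert_commute)
    moreover have "e \<noteq> a" using cyc[of "[b, d, a]"] p q ab \<open>d \<noteq> a\<close> by (auto simp: insert_commute)
    moreover have "e \<noteq> x" using cyc[of "[b, d, x, a]"] p q ab \<open>d \<noteq> a\<close> by (auto simp: insert_commute)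
    moreover have "f \<noteq> a" using cyc[of "[b, d, e, a]"] p q ab \<open>d \<noteq> a\<close> \<open>e \<noteq> a\<close> by (auto simp: insert_commute)
    moreover have "f \<noteq> x" using cyc[of "[b, d, e, x, a]"] p q ab \<open>d \<noteq> a\<close> \<open>d \<noteq> x\<close> \<open>e \<noteq> x\<close> \<open>e \<noteq> a\<close>
      by (auto simp: insert_commute)
    ultimately have "is_path E [f, e, d, b, a, x]" using p q \<open>d \<noteq> a\<close> by (auto simp: insert_commute)
    then show False using no_path_6 by fastforce
  qed
  obtain x where x: "x \<in> D" using component_nonempty[OF comp(2)] by blast
  obtain a b c where p: "is_path E [x, a, b, c]" using P4[OF x] by blast
  have D': "a \<in> D" "b \<in> D" "c \<in> D" using tree_edge(1)[OF D(1)] p x by auto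
  \<comment> \<open>The \<open>P_4\<close> from \<open>b\<close> begins with \<open>b, a\<close> and
    the one from \<open>a\<close> with \<open>a, b\<close>; glued along \<open>ab\<close> they give
    the path \<open>f, e, a, b, e', f'\<close>.\<close>
  obtain d e f where q: "is_path E [b, d, e, f]" using P4[OF D'(2)] by blast
  have [simp]: "d = a" using step[OF x p q] .
  obtain d' e' f' where r: "is_path E [a, d', e', f']" using P4[OF D'(1)] by blast
  have p': "is_path E [c, b, a, x]" using p by (auto simp: insert_commute)
  have [simp]: "d' = b" using step[OF D'(3) p' r] .
  show False
  proof -
    note cyc = tree_no_cycle[OF D(1)]
    have "e' \<noteq> e" using cyc[of "[a, b, e]"] q r D' by (auto simp: insert_commute)
    moreover have "e' \<noteq> f" using cyc[of "[a, b, f, e]"] q r D' by (auto simp: insert_commute)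
    moreover have "f' \<noteq> e" using cyc[of "[a, b, e', e]"] q r D' \<open>e' \<noteq> e\<close> by (auto simp: insert_commute)
    moreover have "f' \<noteq> f" using cyc[of "[a, b, e', f, e]"] q r D' \<open>e' \<noteq> e\<close> \<open>e' \<noteq> f\<close> by (auto simp: insert_commute)
    ultimately have "is_path E [f, e, a, b, e', f']" using q r by (auto simp: insert_commute)
    then show False using no_path_6 by fastforce
  qed
qed

end

section \<open>The lower bound\<close>

text \<open>At most a tenth of \<open>card V\<close> trees occur: by \<open>few_trees\<close> if
  there is a \<open>P_6\<close>, because a \<open>K_2\<close> is the only tree, or because every
  tree has at least ten vertices.\<close>

theorem card_edges_ge:
  assumes "10 * t + 30 \<le> 3 * card V" shows "9 * card V \<le> 10 * card E"
proof -
  have "10 * card {C. tree C} \<le> card V"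
  proof (cases "P6_plus E 0")
    case True
    then show ?thesis using few_trees assms by fastforce
  next
    case False
    show ?thesis
    proof (cases "\<exists>C. tree C \<and> card C = 2")
      case True
      then obtain C where C: "tree C" "card C = 2" by blast
      then have "{D. tree D} = {C}" using K2_only_tree[OF False C] by blast
      then show ?thesis using assms by simp
    next
      case none: False
      then show ?thesis using card_trees_le[of 10] tree_card[OF False] by blast
    qed
  qed
  then show ?thesis using card_V_le by linarith
qed

end

section \<open>The extremal graph\<close>

text \<open>Disjoint trees of depth two: the roots are \<open>0, \<dots>, k - 1\<close>, the next \<open>q\<close> vertices are their children,
  the remaining vertices are leaves below those. Every root has at least three children and every child
  at least two leaves, since children and leaves are distributed cyclically.\<close>

locale extremal_graph =
  fixes k q n :: nat
  assumes k_pos: "0 < k" and k_le_q: "3 * k \<le> q" and q_le_n: "k + 3 * q \<le> n"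
begin

text \<open>On a root the truncated subtraction gives the default 0; \<open>E\<close> uses
  \<open>par\<close> only from \<open>k\<close> on.\<close>

definition par :: "nat \<Rightarrow> nat" where
  "par x = (if x < k + q then (x - k) mod k else k + (x - k - q) mod q)"

definition E :: "nat set set" where
  "E = (\<lambda>x. {x, par x}) ` {k..<n}"

definition mid :: "nat \<Rightarrow> bool" where "mid x \<longleftrightarrow> k \<le> x \<and> x < k + q"

definition leaf :: "nat \<Rightarrow> bool" where "leaf x \<longleftrightarrow> k + q \<le> x \<and> x < n"

text \<open>For a non-root vertex, the centre of its star, where a star is a child together with its
  leaves.\<close>

definition owner :: "nat \<Rightarrow> nat" where "owner x = (if leaf x then par x else x)"

lemma q_pos: "0 < q"
  using k_pos k_le_q by linarith

lemma par_mid: "mid x \<Longrightarrow> par x < k"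
  using k_pos by (simp add: mid_def par_def)

lemma mid_par: "leaf x \<Longrightarrow> mid (par x)"
  using q_pos by (simp add: mid_def leaf_def par_def)

lemma levels: "x < n \<Longrightarrow> x < k \<or> mid x \<or> leaf x"
  by (auto simp: mid_def leaf_def)

lemma par_less: "mid x \<or> leaf x \<Longrightarrow> par x < x"
  using par_mid[of x] mid_par[of x] by (auto simp: mid_def leaf_def)

lemma level_neq: "leaf x \<Longrightarrow> \<not> mid x" "leaf x \<Longrightarrow> \<not> x < k" "mid x \<Longrightarrow> \<not> leaf x" "mid x \<Longrightarrow> \<not> x < k"
  by (auto simp: leaf_def mid_def)

lemma par_edge: "mid x \<or> leaf x \<Longrightarrow> {x, par x} \<in> E"
  using q_le_n by (auto simp: E_def mid_def leaf_def)

lemma edgeE: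
  assumes "{x, y} \<in> E"
  obtains "mid x \<or> leaf x" "y = par x" | "mid y \<or> leaf y" "x = par y"
proof -
  obtain z where "z \<in> {k..<n}" "{x, y} = {z, par z}" using assms by (auto simp: E_def)
  then have "mid z \<or> leaf z" by (auto simp: mid_def leaf_def)
  moreover have "x = z \<and> y = par z \<or> x = par z \<and> y = z"
    using \<open>{x, y} = {z, par z}\<close> by (auto simp: doubleton_eq_iff)
  ultimately show thesis using that by blast
qed

text \<open>Among the three children \<open>k + r\<close>, \<open>2 * k + r\<close>,
  \<open>3 * k + r\<close> one differs from two prescribed vertices.\<close>

lemma ex_mid:
  assumes "r < k" obtains c where "mid c" "par c = r" "c \<noteq> x" "c \<noteq> y"
proof -
  have "mid (i * k + r) \<and> par (i * k + r) = r" if i: "i \<in> {1, 2, 3}" for i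
  proof -
    have "mid (i * k + r)" using i assms k_le_q by (auto simp: mid_def)
    moreover have "i * k + r - k = (i - 1) * k + r" using i by (auto simp: algebra_simps)
    ultimately show ?thesis using assms by (simp add: mid_def par_def)
  qed
  moreover have "\<exists>i\<in>{1, 2, 3}. i * k + r \<noteq> x \<and> i * k + r \<noteq> y"
    using k_pos by auto
  ultimately show thesis using that by blast
qed

lemma ex_leaf:
  assumes "mid c" obtains l where "leaf l" "par l = c" "l \<noteq> x"
proof -
  obtain j where j: "c = k + j" "j < q" using assms by (auto simp: mid_def le_iff_add)
  have "leaf (k + q + j) \<and> par (k + q + j) = c" using j q_le_n by (auto simp: leaf_def par_def)
  moreover have "leaf (k + 2 * q + j) \<and> par (k + 2 * q + j) = c"
  proof -
    have "(k + 2 * q + j - k - q) mod q = j" using j(2) by (simp add: mod_add_cong)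
    then show ?thesis using j q_le_n by (auto simp: leaf_def par_def)
  qed
  moreover have "k + q + j \<noteq> k + 2 * q + j" using q_pos by simp
  ultimately show thesis using that by metis
qed

lemma edge_E: "e \<in> E \<Longrightarrow> e \<subseteq> {..<n} \<and> card e = 2"
proof -
  assume "e \<in> E"
  then obtain x where x: "x \<in> {k..<n}" "e = {x, par x}" by (auto simp: E_def)
  then have "mid x \<or> leaf x" by (auto simp: mid_def leaf_def)
  then have "par x < x" by (rule par_less)
  then show ?thesis using x by auto
qed

text \<open>Parents have smaller numbers, so an edge determines its lower vertex in the tree as its
  larger end; only the \<open>k\<close> roots have no parent edge.\<close>

lemma card_E: "card E = n - k"
proof -
  have "inj_on (\<lambda>x. {x, par x}) {k..<n}"
  proof (rule inj_onI)
    fix x y assume xy: "x \<in> {k..<n}" "y \<in> {k..<n}" "{x, par x} = {y, par y}"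
    then have "par x < x" "par y < y" by (auto intro!: par_less simp: mid_def leaf_def)
    then show "x = y" using xy(3) by (auto simp: doubleton_eq_iff)
  qed
  then show ?thesis by (simp add: E_def card_image)
qed

lemma no_isolated_E: "x < n \<Longrightarrow> \<exists>e\<in>E. x \<in> e"
proof -
  assume "x < n"
  then consider "x < k" | "mid x \<or> leaf x" using levels by blast
  then show ?thesis
  proof cases
    case 1
    then obtain c where "mid c" "par c = x" by (rule ex_mid)
    then show ?thesis using par_edge[of c] by auto
  next
    case 2
    then show ?thesis using par_edge[of x] by auto
  qed
qed

text \<open>Leaves have degree one, so the four inner vertices of a \<open>P_6\<close> are no
  leaves. The middle edge has a child as one end, and both path neighbours of this child would have
  to be its root.\<close>

lemma no_P6_E: "\<not> P6_plus E t"
proof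
  assume "P6_plus E t"
  then obtain p where "is_path E p" "length p = 6" by (rule P6_plusE)
  then obtain a b c d e f where p: "is_path E [a, b, c, d, e, f]" by (auto simp: length_6_conv)
  have leaf: "y = par x" if "leaf x" "{x, y} \<in> E" for x y
    using that(2) by (rule edgeE) (use that(1) par_mid[of y] mid_par[of y] level_neq in auto)
  have not_leaf: "\<not> leaf x" if "{w, x} \<in> E" "{x, y} \<in> E" "w \<noteq> y" for w x y
    using leaf[of x w] leaf[of x y] that by (auto simp: insert_commute)
  have root: "y < k \<and> y = par x" if "mid x" "{x, y} \<in> E" "\<not> leaf y" for x y
    using that(2) by (rule edgeE) (use that(1,3) par_mid[of x] par_mid[of y] level_neq in auto)
  have mid_mid: "mid x \<or> mid y" if "{x, y} \<in> E" "\<not> leaf x" "\<not> leaf y" for x y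
    using that(1) by (rule edgeE) (use that level_neq in auto)
  have nl: "\<not> leaf b" "\<not> leaf c" "\<not> leaf d" "\<not> leaf e"
    using not_leaf[of a b c] not_leaf[of b c d] not_leaf[of c d e] not_leaf[of d e f] p by auto
  have "mid c \<or> mid d" using mid_mid[of c d] p nl by simp
  then show False
  proof
    assume "mid c"
    then have "b = par c" "d = par c" using root[of c b] root[of c d] p nl by (auto simp: insert_commute)
    then show False using p by simp
  next
    assume "mid d"
    then have "c = par d" "e = par d" using root[of d c] root[of d e] p nl by (auto simp: insert_commute)
    then show False using p by simp
  qed
qed

section \<open>Saturation of the extremal graph\<close>

text \<open>\<open>J\<close> contains the centres of all stars met by the path. Each of the
  remaining stars, at least \<open>q - 3\<close> of them, supplies one matching edge.\<close>

lemma P6_plusI_owner: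
  assumes p: "is_path E' p" "length p = 6" and "E \<subseteq> E'" "t + 3 \<le> q"
    and J: "finite J" "card J \<le> 3" "\<And>x. x \<in> set p \<Longrightarrow> x < k \<or> owner x \<in> J"
  shows "P6_plus E' t"
proof -
  define A where "A = {k..<k + q} - J"
  \<comment> \<open>\<open>c + q\<close> is the first leaf below the child \<open>c\<close>.\<close>
  define M where "M = (\<lambda>c. {c, c + q}) ` A"
  have A: "mid c" "leaf (c + q)" "par (c + q) = c" "c \<notin> J" if "c \<in> A" for c
    using that q_le_n by (auto simp: A_def mid_def leaf_def par_def)
  have "card {k..<k + q} - card J \<le> card A" unfolding A_def by (rule diff_card_le_card_Diff[OF J(1)])
  then have "t \<le> card A" using J(2) assms(4) by simp
  have disj: "c = c'" if "c \<in> A" "c' \<in> A" "{c, c + q} \<inter> {c', c' + q} \<noteq> {}" for c c'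
  proof -
    have "c < k + q" "k \<le> c" "c' < k + q" "k \<le> c'" using that(1,2) by (simp_all add: A_def)
    then show ?thesis using that(3) by auto
  qed
  have "inj_on (\<lambda>c. {c, c + q}) A" by (rule inj_onI) (use disj in blast)
  then have "card M = card A" by (simp add: M_def card_image)
  moreover have "matching M"
  proof -
    have "e \<inter> f = {}" if ef: "e \<in> M" "f \<in> M" "e \<noteq> f" for e f
    proof -
      obtain c d where "c \<in> A" "d \<in> A" "e = {c, c + q}" "f = {d, d + q}" using ef(1,2) by (auto simp: M_def)
      then show ?thesis using disj[of c d] ef(3) by metis
    qed
    then show ?thesis by (simp add: matching_def pairwise_def disjnt_def)
  qed
  moreover have "M \<subseteq> E'"
  proof
    fix e assume "e \<in> M"
    then obtain c where c: "c \<in> A" "e = {c, c + q}" by (auto simp: M_def)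
    then have "e \<in> E" using par_edge[of "c + q"] A[OF c(1)] by (simp add: insert_commute)
    then show "e \<in> E'" using assms(3) by blast
  qed
  moreover have "e \<inter> set p = {}" if e: "e \<in> M" for e
  proof -
    obtain c where c: "c \<in> A" "e = {c, c + q}" using e by (auto simp: M_def)
    have "c \<notin> set p" using J(3)[of c] A[OF c(1)] by (auto simp: owner_def level_neq)
    moreover have "c + q \<notin> set p" using J(3)[of "c + q"] A[OF c(1)] by (auto simp: owner_def level_neq)
    ultimately show ?thesis using c(2) by simp
  qed
  moreover have "finite M" by (simp add: M_def A_def)
  ultimately have "P6_plus E' (card A)" using p by (intro P6_plusI[of E' p M]) auto
  then show ?thesis using \<open>t \<le> card A\<close> by (rule P6_plus_less)
qed

text \<open>For each pair of levels of \<open>x\<close> and \<open>y\<close> a \<open>P_6\<close>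
  through the new edge is written down that meets at most three stars. The spare children and leaves
  avoid the vertices already in use.\<close>

lemma saturated_E:
  assumes "x < y" "y < n" "{x, y} \<notin> E" "t + 3 \<le> q"
  shows "P6_plus (insert {x, y} E) t"
proof -
  define E' where "E' = insert {x, y} E"
  have up: "{z, par z} \<in> E'" "{par z, z} \<in> E'" if "mid z \<or> leaf z" for z
    using par_edge[OF that] by (simp_all add: E'_def insert_commute)
  have new: "{x, y} \<in> E'" "{y, x} \<in> E'" by (simp_all add: E'_def insert_commute)
  have P: "P6_plus E' t"
    if "is_path E' p" "length p = 6" and J: "\<forall>x\<in>set p. x < k \<or> owner x \<in> {a, b, c}" for p a b c
  proof (rule P6_plusI_owner[OF that(1,2) _ assms(4)])
    show "card {a, b, c} \<le> 3" using card_length[of "[a, b, c]"] by simp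
    show "x < k \<or> owner x \<in> {a, b, c}" if "x \<in> set p" for x
      using J that by (rule bspec)
  qed (auto simp: E'_def)
  have own: "owner z = par z" if "leaf z" for z using that level_neq by (simp add: owner_def)
  have own': "owner z = z" if "mid z" for z using that level_neq by (simp add: owner_def)
  \<comment> \<open>The levels are consecutive intervals of numbers, so \<open>x < y\<close> leaves
    six of the nine combinations.\<close>
  consider "x < k" "y < k" | "x < k" "mid y" | "x < k" "leaf y" | "mid x" "mid y" | "mid x" "leaf y"
    | "leaf x" "leaf y"
    using levels[OF assms(2)] levels[of x] assms(1,2) by (fastforce simp: mid_def leaf_def)
  then have "P6_plus E' t"
  proof cases
    case 1
    obtain c where c: "mid c" "par c = x" using ex_mid[OF 1(1)] by metis
    obtain l where l: "leaf l" "par l = c" using ex_leaf[OF c(1)] by metis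
    obtain d where d: "mid d" "par d = y" using ex_mid[OF 1(2)] by metis
    obtain m where m: "leaf m" "par m = d" using ex_leaf[OF d(1)] by metis
    have ne: "c \<noteq> d" "l \<noteq> m" using c d l m assms(1) by auto
    show ?thesis
    proof (rule P)
      have "distinct [l, c, x, y, d, m]" using ne 1 c l d m assms(1) by (auto simp: mid_def leaf_def)
      moreover have "successively (\<lambda>u v. {u, v} \<in> E') [l, c, x, y, d, m]"
        using 1 c l d m assms(1) up[of c] up[of l] up[of d] up[of m] new by simp
      ultimately show "is_path E' [l, c, x, y, d, m]" by (simp add: is_path_def)
      \<comment> \<open>Only two stars are met; the repeated entry merely fills the third
        place.\<close>
      show "\<forall>v\<in>set [l, c, x, y, d, m]. v < k \<or> owner v \<in> {c, d, d}" using 1 c l d m assms(1) by (simp add: own own')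
    qed simp
  next
    case 2
    have "par y \<noteq> x" using par_edge[of y] 2 assms(3) by (auto simp: insert_commute)
    have r: "par y < k" using 2(2) by (rule par_mid)
    obtain c where c: "mid c" "par c = x" using ex_mid[OF 2(1)] by metis
    obtain d where d: "mid d" "par d = par y" "d \<noteq> y" using ex_mid[OF r] by metis
    obtain m where m: "leaf m" "par m = d" using ex_leaf[OF d(1)] by metis
    have ne: "c \<noteq> d" "c \<noteq> y" using c d \<open>par y \<noteq> x\<close> by auto
    show ?thesis
    proof (rule P)
      have "distinct [c, x, y, par y, d, m]" using ne 2 r c d m assms(1) \<open>par y \<noteq> x\<close> by (auto simp: mid_def leaf_def)
      moreover have "successively (\<lambda>u v. {u, v} \<in> E') [c, x, y, par y, d, m]"
        using 2 r c d m assms(1) \<open>par y \<noteq> x\<close> up[of c] up[of d] up[of m] up[of y] new by simp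
      ultimately show "is_path E' [c, x, y, par y, d, m]" by (simp add: is_path_def)
      show "\<forall>v\<in>set [c, x, y, par y, d, m]. v < k \<or> owner v \<in> {c, y, d}" using 2 r c d m assms(1) \<open>par y \<noteq> x\<close> by (simp add: own own')
    qed simp
  next
    case 3
    have y: "mid (par y)" using 3(2) by (rule mid_par)
    obtain c where c: "mid c" "par c = x" "c \<noteq> par y" using ex_mid[OF 3(1)] by metis
    obtain l where l: "leaf l" "par l = c" using ex_leaf[OF c(1)] by metis
    obtain m where m: "leaf m" "par m = par y" "m \<noteq> y" using ex_leaf[OF y] by metis
    have ne: "l \<noteq> y" "l \<noteq> m" using c l m by auto
    show ?thesis
    proof (rule P)
      have "distinct [l, c, x, y, par y, m]" using ne 3 y c l m assms(1) by (auto simp: mid_def leaf_def)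
      moreover have "successively (\<lambda>u v. {u, v} \<in> E') [l, c, x, y, par y, m]"
        using 3 y c l m assms(1) up[of c] up[of l] up[of m] up[of y] new by simp
      ultimately show "is_path E' [l, c, x, y, par y, m]" by (simp add: is_path_def)
      show "\<forall>v\<in>set [l, c, x, y, par y, m]. v < k \<or> owner v \<in> {c, par y, par y}" using 3 y c l m assms(1) by (simp add: own own')
    qed simp
  next
    case 4
    have r: "par y < k" using 4(2) by (rule par_mid)
    obtain l where l: "leaf l" "par l = x" using ex_leaf[OF 4(1)] by metis
    \<comment> \<open>\<open>x\<close> may be a child of the same root as \<open>y\<close>, so
      \<open>d\<close> has to avoid both.\<close>
    obtain d where d: "mid d" "par d = par y" "d \<noteq> y" "d \<noteq> x" using ex_mid[OF r] by metis
    obtain m where m: "leaf m" "par m = d" using ex_leaf[OF d(1)] by metis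
    have ne: "l \<noteq> m" using l m d by auto
    show ?thesis
    proof (rule P)
      have "distinct [l, x, y, par y, d, m]" using ne 4 r l d m assms(1) by (auto simp: mid_def leaf_def)
      moreover have "successively (\<lambda>u v. {u, v} \<in> E') [l, x, y, par y, d, m]"
        using 4 r l d m assms(1) up[of d] up[of l] up[of m] up[of y] new by simp
      ultimately show "is_path E' [l, x, y, par y, d, m]" by (simp add: is_path_def)
      show "\<forall>v\<in>set [l, x, y, par y, d, m]. v < k \<or> owner v \<in> {x, y, d}" using 4 r l d m assms(1) by (simp add: own own')
    qed simp
  next
    case 5
    have y: "mid (par y)" using 5(2) by (rule mid_par)
    have r: "par (par y) < k" using y by (rule par_mid)
    have "par y \<noteq> x" using par_edge[of y] 5 assms(3) by (auto simp: insert_commute)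
    obtain l where l: "leaf l" "par l = x" using ex_leaf[OF 5(1)] by metis
    obtain d where d: "mid d" "par d = par (par y)" "d \<noteq> par y" "d \<noteq> x" using ex_mid[OF r] by metis
    have ne: "l \<noteq> y" using l \<open>par y \<noteq> x\<close> by auto
    show ?thesis
    proof (rule P)
      have "distinct [l, x, y, par y, par (par y), d]" using ne 5 y r l d assms(1) \<open>par y \<noteq> x\<close> by (auto simp: mid_def leaf_def)
      moreover have "successively (\<lambda>u v. {u, v} \<in> E') [l, x, y, par y, par (par y), d]"
        using 5 y r l d assms(1) \<open>par y \<noteq> x\<close> up[of d] up[of l] up[of y] up[of "par y"] new by simp
      ultimately show "is_path E' [l, x, y, par y, par (par y), d]" by (simp add: is_path_def)
      show "\<forall>v\<in>set [l, x, y, par y, par (par y), d]. v < k \<or> owner v \<in> {x, par y, d}" using 5 y r l d assms(1) \<open>par y \<noteq> x\<close> by (simp add: own own')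
    qed simp
  next
    case 6
    have x: "mid (par x)" and y: "mid (par y)" using 6 by (simp_all add: mid_par)
    show ?thesis
    \<comment> \<open>Two leaves of one star continue through their centre and root into another
      star; leaves of different stars need no root.\<close>
    proof (cases "par x = par y")
      case True
      have r: "par (par y) < k" using y by (rule par_mid)
      obtain d where d: "mid d" "par d = par (par y)" "d \<noteq> par y" using ex_mid[OF r] by metis
      obtain m where m: "leaf m" "par m = d" using ex_leaf[OF d(1)] by metis
      have ne: "m \<noteq> x" "m \<noteq> y" using m d True by auto
      show ?thesis
      proof (rule P)
        have "distinct [x, y, par y, par (par y), d, m]" using ne 6 True y r d m assms(1) by (auto simp: mid_def leaf_def)
        moreover have "successively (\<lambda>u v. {u, v} \<in> E') [x, y, par y, par (par y), d, m]"
          using 6 True y r d m assms(1) up[of d] up[of m] up[of y] up[of "par y"] new by simp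
        ultimately show "is_path E' [x, y, par y, par (par y), d, m]" by (simp add: is_path_def)
        show "\<forall>v\<in>set [x, y, par y, par (par y), d, m]. v < k \<or> owner v \<in> {par y, d, d}" using 6 True y r d m assms(1) by (simp add: own own')
      qed simp
    next
      case False
      obtain l where l: "leaf l" "par l = par x" "l \<noteq> x" using ex_leaf[OF x] by metis
      obtain m where m: "leaf m" "par m = par y" "m \<noteq> y" using ex_leaf[OF y] by metis
      have ne: "l \<noteq> y" "m \<noteq> x" "l \<noteq> m" using l m False by auto
      show ?thesis
      proof (rule P)
        have "distinct [l, par x, x, y, par y, m]" using ne 6 False x y l m assms(1) by (auto simp: mid_def leaf_def)
        moreover have "successively (\<lambda>u v. {u, v} \<in> E') [l, par x, x, y, par y, m]"
          using 6 False x y l m assms(1) up[of l] up[of m] up[of x] up[of y] new by simp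
        ultimately show "is_path E' [l, par x, x, y, par y, m]" by (simp add: is_path_def)
        show "\<forall>v\<in>set [l, par x, x, y, par y, m]. v < k \<or> owner v \<in> {par x, par y, par y}" using 6 False x y l m assms(1) by (simp add: own own')
      qed simp
    qed
  qed
  then show ?thesis by (simp add: E'_def)
qed

end

section \<open>Transfer to graphs and conclusion\<close>

lemma edges_saturated_ge:
  assumes "saturated (P6_tP2 t) G" "\<nexists>v. isolated G v" "10 * t + 30 \<le> 3 * card (verts G)"
  shows "9 * card (verts G) \<le> 10 * card (edges G)"
proof -
  have simple: "simple_graph G" using assms(1) by (simp add: saturated_def)
  interpret saturated_graph "verts G" "edges G" t
  proof
    show "\<not> P6_plus (edges G) t"
      using assms(1) contains_P6_tP2_iff[OF simple] by (simp add: saturated_def)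
    show "P6_plus (insert {x, y} (edges G)) t"
      if xy: "x \<in> verts G" "y \<in> verts G" "x \<noteq> y" "{x, y} \<notin> edges G" for x y
    proof -
      have "{x, y} \<in> edges (complement G)" using xy by (simp add: complement_def)
      then have "contains_copy (add_edge G {x, y}) (P6_tP2 t)" using assms(1) by (simp add: saturated_def)
      moreover have "simple_graph (add_edge G {x, y})"
        using simple xy by (auto simp: simple_graph_def add_edge_def)
      ultimately show ?thesis using contains_P6_tP2_iff[of "add_edge G {x, y}" t] by (simp add: add_edge_def)
    qed
    show "\<exists>e\<in>edges G. x \<in> e" if "x \<in> verts G" for x using assms(2) that by (auto simp: isolated_def)
  qed (use simple in \<open>auto simp: simple_graph_def\<close>)
  show ?thesis using assms(3) by (rule card_edges_ge)
qed

lemma (in extremal_graph) saturated_extremal: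
  assumes "t + 3 \<le> q"
  shows "saturated (P6_tP2 t) (UGraph {..<n} E)"
proof -
  let ?G = "UGraph {..<n} E"
  have simple: "simple_graph ?G" using edge_E by (simp add: simple_graph_def)
  have "contains_copy (add_edge ?G e) (P6_tP2 t)" if e: "e \<in> edges (complement ?G)" for e
  proof -
    have e': "e \<subseteq> {..<n}" "card e = 2" "e \<notin> E" using e by (simp_all add: complement_def)
    then obtain x y where xy: "e = {x, y}" "x < y" by (metis card_2_iff insert_commute linorder_neqE_nat)
    then have "P6_plus (insert e E) t" using saturated_E[of x y t] e' assms by simp
    moreover have "simple_graph (add_edge ?G e)"
      using simple e' by (simp add: simple_graph_def add_edge_def)
    ultimately show ?thesis using contains_P6_tP2_iff[of "add_edge ?G e" t] by (simp add: add_edge_def)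
  qed
  moreover have "\<not> contains_copy ?G (P6_tP2 t)" using contains_P6_tP2_iff[OF simple] no_P6_E by simp
  ultimately show ?thesis using simple by (simp add: saturated_def)
qed

theorem theorem3p2:
  fixes n t :: nat
  assumes "n > 0" and "t > 0" and "real n \<ge> 10 * real t / 3 + 10"
  shows "is_minimum
           (saturated_edge_counts (disjoint_union (path_graph 6) (copies t (path_graph 2))) n)
           (n - nat \<lfloor>real n / 10\<rfloor>)"
proof -
  have nt: "10 * t + 30 \<le> 3 * n" using assms(3) by linarith
  have floor: "nat \<lfloor>real n / 10\<rfloor> = n div 10" by (simp add: floor_divide_of_nat_eq[of n 10, simplified])
  define k where "k = n div 10"
  \<comment> \<open>One third of the non-roots become children, which leaves at least two leaves per
    child.\<close>
  define q where "q = (n - k) div 3"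
  have k: "10 * k \<le> n" "n < 10 * k + 10" unfolding k_def by linarith+
  have q: "3 * q \<le> n - k" "n - k < 3 * q + 3" unfolding q_def by linarith+
  interpret extremal_graph k q n
    by unfold_locales (use k q nt assms(2) in linarith)+
  \<comment> \<open>By \<open>nt\<close>, \<open>n - k\<close> is at least
    \<open>9 * n / 10\<close>, hence at least \<open>3 * t + 9\<close>.\<close>
  have "t + 3 \<le> q" using k q nt by linarith
  then have "saturated (P6_tP2 t) (UGraph {..<n} E)" by (rule saturated_extremal)
  moreover have "\<nexists>v. isolated (UGraph {..<n} E) v" using no_isolated_E by (auto simp: isolated_def)
  ultimately have "n - k \<in> saturated_edge_counts (P6_tP2 t) n"
    unfolding saturated_edge_counts_def using card_E
    by (intro CollectI exI[of _ "UGraph {..<n} E"]) simp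
  moreover have "n - k \<le> m" if m: "m \<in> saturated_edge_counts (P6_tP2 t) n" for m
  proof -
    obtain G :: "nat ugraph" where G: "m = card (edges G)" "saturated (P6_tP2 t) G" "card (verts G) = n"
      "\<nexists>v. isolated G v"
      using m unfolding saturated_edge_counts_def by blast
    then have "9 * n \<le> 10 * m" using edges_saturated_ge[of t G] nt by simp
    \<comment> \<open>\<open>n - m\<close> is an integer and at most \<open>n / 10\<close>, hence at
      most \<open>k\<close>.\<close>
    then show ?thesis using k by linarith
  qed
  ultimately show ?thesis unfolding is_minimum_def floor k_def by blast
qed

end
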